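(* Let $p$ be an odd prime and let $G$ be a finite $p$-group of nilpotency class $n_c$ with $2\le n_c\le p-1$. Let $p^r=\exp(G/Z(G))$ and $p^t=\exp(\gamma_3(G))$ with $r,t\in\mathbb{Z}_{\ge 0}$, and let $$T_0(G)=\{n+p^r\mathbb{Z} : p\nmid n \text{ and } n\equiv 1 \pmod{p^t}\},$$ regarded as a subgroup of $(\mathbb{Z}/p^r\mathbb{Z})^\times$. For $n\in\mathbb{Z}$ let $\pi_n:G\to G$, $\pi_n(x)=x^n$. Then the map $$\kappa:T_0(G)\to T(G),\qquad \kappa(n+p^r\mathbb{Z})=\pi_n\mathrm{Hol}(G)$$ (where the representative $n$ is an integer with $p\nmid n$ and $n\equiv1\pmod{p^t}$) is a well-defined injective group homomorphism.
   Context: $Z(G)$ is the center of $G$, $\exp$ denotes the exponent of a group, and $\gamma_1(G)=G$, $\gamma_i(G)=[G,\gamma_{i-1}(G)]$ for $i\ge2$ is the lower central series. $\mathrm{Perm}(G)$ is the symmetric group of the set $G$, $\rho(\sigma)=(x\mapsto x\sigma^{-1})$ is the right regular representation, $\mathrm{Hol}(G)=\rho(G)\rtimes\mathrm{Aut}(G)\le\mathrm{Perm}(G)$ is the holomorph, $\mathrm{NHol}(G)=\mathrm{Norm}_{\mathrm{Perm}(G)}(\mathrm{Hol}(G))$ is the multiple holomorph, and $T(G)=\mathrm{NHol}(G)/\mathrm{Hol}(G)$. "Well-defined" includes that $\pi_n\in\mathrm{NHol}(G)$ for such $n$ and that the coset $\pi_n\mathrm{Hol}(G)$ depends only on the class $n+p^r\mathbb{Z}$.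 *)

theory Defs
  imports "HOL-Algebra.Algebra" "HOL-Number_Theory.Cong"
begin

definition group_center :: "('a, 'b) monoid_scheme \<Rightarrow> 'a set" where
  "group_center G = {z \<in> carrier G. \<forall>x \<in> carrier G. z \<otimes>\<^bsub>G\<^esub> x = x \<otimes>\<^bsub>G\<^esub> z}"

text \<open>Only meaningful for groups of finite exponent, in particular for finite groups.\<close>

definition group_exponent :: "('a, 'b) monoid_scheme \<Rightarrow> nat" where
  "group_exponent G = (LEAST n. 0 < n \<and> (\<forall>x \<in> carrier G. x [^]\<^bsub>G\<^esub> n = \<one>\<^bsub>G\<^esub>))"

definition commutator_subgroup :: "('a, 'b) monoid_scheme \<Rightarrow> 'a set \<Rightarrow> 'a set \<Rightarrow> 'a set" where
  "commutator_subgroup G H K =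
     generate G {x \<otimes>\<^bsub>G\<^esub> y \<otimes>\<^bsub>G\<^esub> inv\<^bsub>G\<^esub> x \<otimes>\<^bsub>G\<^esub> inv\<^bsub>G\<^esub> y | x y. x \<in> H \<and> y \<in> K}"

text \<open>The series is indexed from 1; the value at 0 is a dummy.\<close>

primrec lower_central_series :: "('a, 'b) monoid_scheme \<Rightarrow> nat \<Rightarrow> 'a set" where
  "lower_central_series G 0 = carrier G"
| "lower_central_series G (Suc i) =
     (if i = 0 then carrier G
      else commutator_subgroup G (carrier G) (lower_central_series G i))"

definition has_nilpotency_class :: "('a, 'b) monoid_scheme \<Rightarrow> nat \<Rightarrow> bool" where
  "has_nilpotency_class G c \<longleftrightarrow>
     lower_central_series G (c + 1) = {\<one>\<^bsub>G\<^esub>} \<and>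
     (\<forall>i < c. lower_central_series G (i + 1) \<noteq> {\<one>\<^bsub>G\<^esub>})"

text \<open>
  The symmetric group of the set \<open>carrier G\<close> is \<open>BijGroup (carrier G)\<close>, whose elements are
  functions that are \<open>undefined\<close> outside the carrier; hence the restricted abstractions
  below. Its product \<open>g \<otimes> f\<close> is the composition that applies \<open>f\<close> first.
\<close>

definition right_regular :: "('a, 'b) monoid_scheme \<Rightarrow> 'a \<Rightarrow> 'a \<Rightarrow> 'a" where
  "right_regular G s = (\<lambda>x \<in> carrier G. x \<otimes>\<^bsub>G\<^esub> inv\<^bsub>G\<^esub> s)"

text \<open>The semidirect product is internal: the product set of the two subgroups.\<close>

definition Hol :: "('a, 'b) monoid_scheme \<Rightarrow> ('a \<Rightarrow> 'a) set" where
  "Hol G = (right_regular G ` carrier G) <#>\<^bsub>BijGroup (carrier G)\<^esub> auto G"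

definition NHol :: "('a, 'b) monoid_scheme \<Rightarrow> ('a \<Rightarrow> 'a) set" where
  "NHol G = normalizer (BijGroup (carrier G)) (Hol G)"

text \<open>
  \<open>Mod\<close> is formed from right cosets; as \<open>Hol G\<close> is normal in \<open>NHol G\<close>, these are also
  the left cosets.
\<close>

definition NHol_mod_Hol :: "('a, 'b) monoid_scheme \<Rightarrow> ('a \<Rightarrow> 'a) set monoid" where
  "NHol_mod_Hol G = (BijGroup (carrier G)) \<lparr>carrier := NHol G\<rparr> Mod Hol G"

definition power_map :: "('a, 'b) monoid_scheme \<Rightarrow> int \<Rightarrow> 'a \<Rightarrow> 'a" where
  "power_map G n = (\<lambda>x \<in> carrier G. x [^]\<^bsub>G\<^esub> n)"

text \<open>The class of \<open>n\<close> modulo \<open>k\<close>, as an element of the quotient ring \<open>ZFact k\<close>.\<close>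

definition residue_class :: "int \<Rightarrow> int \<Rightarrow> int set" where
  "residue_class k n = Idl\<^bsub>\<Z>\<^esub> {k} +>\<^bsub>\<Z>\<^esub> n"

lemma residue_class_eq: "residue_class k n = {m. [m = n] (mod k)}"
proof -
  have "Idl\<^bsub>\<Z>\<^esub> {k} = PIdl\<^bsub>\<Z>\<^esub> k"
    by (simp add: int.cgenideal_eq_genideal)
  then have "residue_class k n = {x * k + n | x. True}"
    by (auto simp: residue_class_def a_r_coset_def' cgenideal_def)
  moreover have "[m = n] (mod k) \<longleftrightarrow> (\<exists>x. m = x * k + n)" for m
  proof -
    have "[m = n] (mod k) \<longleftrightarrow> (\<exists>x. m - n = k * x)"
      by (simp add: cong_iff_dvd_diff dvd_def)
    also have "\<dots> \<longleftrightarrow> (\<exists>x. m = x * k + n)"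
      by (rule ex_cong1) (simp add: diff_eq_eq mult.commute)
    finally show ?thesis .
  qed
  ultimately show ?thesis
    by simp
qed

definition admissible :: "nat \<Rightarrow> nat \<Rightarrow> int \<Rightarrow> bool" where
  "admissible p t n \<longleftrightarrow> \<not> int p dvd n \<and> [n = 1] (mod (int p ^ t))"

definition T0 :: "nat \<Rightarrow> nat \<Rightarrow> nat \<Rightarrow> int set set" where
  "T0 p r t = {residue_class (int p ^ r) n | n. admissible p t n}"

end

theory Submission
  imports Defs
begin

text \<open>
  Let \<open>q = p ^ t\<close> and let \<open>n\<close> be prime to \<open>p\<close> with \<open>n\<close> congruent to 1 modulo \<open>q\<close>. Hall's collection
  formula compares the \<open>n\<close>-th power of \<open>x y\<close> with the product of the \<open>n\<close>-th powers of \<open>x\<close> and \<open>y\<close>,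
  up to factors \<open>c\<^sub>i\<close> raised to \<open>n choose i\<close>, with \<open>c\<^sub>i\<close> in the \<open>i\<close>-th term of the lower central
  series and \<open>i \<ge> 2\<close>. For \<open>2 \<le> i < p\<close> the binomial coefficient is a multiple of \<open>q\<close>; from \<open>i = 3\<close> on
  the factor is then trivial, because \<open>q\<close> kills the third term and the terms from \<open>p\<close> on are trivial.
  Only \<open>[y, x]\<close> to the power \<open>n choose 2\<close> survives (\<open>Hall_formula_small_class\<close>). The same argument
  shows that, for \<open>N\<close> a multiple of \<open>q\<close>, the map taking \<open>(x, y)\<close> to \<open>[x, y]\<close> to the power \<open>N\<close> has
  central values and is multiplicative in both arguments, and that it equals the commutator of the
  \<open>N\<close>-th power of \<open>x\<close> with \<open>y\<close> (\<open>commutator_of_pow\<close>).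

  Two facts about the power map \<open>\<pi>\<^sub>n\<close> follow. First, conjugation by \<open>\<pi>\<^sub>n\<close> turns a right translation into
  a right translation composed with an automorphism \<open>w \<mapsto> w b(w)\<close>, where \<open>b(w)\<close> is a central power of
  a commutator; hence \<open>\<pi>\<^sub>n\<close> normalizes the holomorph (\<open>power_map_normalizes_Hol\<close>). Second, \<open>\<pi>\<^sub>n\<close> lies in
  the holomorph iff it is an automorphism, iff all powers with exponent \<open>n choose 2\<close> are
  central, iff \<open>n\<close> is congruent to 1 modulo \<open>p ^ r\<close> (\<open>power_map_in_Hol_iff\<close>). Since
  \<open>\<pi>\<^sub>m \<pi>\<^sub>n = \<pi>\<^sub>m\<^sub>n\<close>, the coset of \<open>\<pi>\<^sub>n\<close> therefore determines, and is determined by, the class of \<open>n\<close>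
  modulo \<open>p ^ r\<close>, multiplicatively in \<open>n\<close>.

  Hall's formula is obtained from polynomial sequences instead of a collection process. A sequence in a
  filtered group is polynomial if its \<open>j\<close>-th iterated difference takes values in the \<open>j\<close>-th term. The
  condition on one further difference turns a filtration of the group of sequences into another
  filtration (\<open>derived_filtered_group\<close>), so polynomial sequences are closed under multiplication and
  have Taylor expansions whose coefficients lie in the terms of the filtration.
\<close>

section \<open>Commutators and the lower central series\<close>

definition group_commutator :: "('a, 'b) monoid_scheme \<Rightarrow> 'a \<Rightarrow> 'a \<Rightarrow> 'a" where
  "group_commutator G x y = x \<otimes>\<^bsub>G\<^esub> y \<otimes>\<^bsub>G\<^esub> inv\<^bsub>G\<^esub> x \<otimes>\<^bsub>G\<^esub> inv\<^bsub>G\<^esub> y"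

declare lower_central_series.simps(2) [simp del]

lemma lower_central_series_1 [simp]: "lower_central_series G (Suc 0) = carrier G"
  by (simp add: lower_central_series.simps(2))

context group
begin

lemma mult_inv_cancel_left:
  assumes "x \<in> carrier G" "y \<in> carrier G"
  shows "x \<otimes> (inv x \<otimes> y) = y" and "inv x \<otimes> (x \<otimes> y) = y"
  using assms by (simp_all add: m_assoc [symmetric])

text \<open>
  These rules bring a group word to its reduced form, so that the simplifier decides every
  identity that holds in free groups.
\<close>

lemmas free_reduce = m_assoc inv_mult_group mult_inv_cancel_left

lemma group_commutator_closed [simp]:
  "x \<in> carrier G \<Longrightarrow> y \<in> carrier G \<Longrightarrow> group_commutator G x y \<in> carrier G"
  by (simp add: group_commutator_def)

lemma inv_group_commutator:
  "x \<in> carrier G \<Longrightarrow> y \<in> carrier G \<Longrightarrow> inv (group_commutator G x y) = group_commutator G y x"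
  by (simp add: group_commutator_def free_reduce)

lemma group_commutator_mult_left:
  assumes "x \<in> carrier G" "x' \<in> carrier G" "y \<in> carrier G"
  shows "group_commutator G (x \<otimes> x') y =
    x \<otimes> group_commutator G x' y \<otimes> inv x \<otimes> group_commutator G x y"
  using assms by (simp add: group_commutator_def free_reduce)

lemma group_commutator_inv_left:
  assumes "x \<in> carrier G" "y \<in> carrier G"
  shows "group_commutator G (inv x) y = inv x \<otimes> group_commutator G y x \<otimes> x"
  using assms by (simp add: group_commutator_def free_reduce)

lemma conj_eq_group_commutator_mult:
  assumes "x \<in> carrier G" "y \<in> carrier G"
  shows "x \<otimes> y \<otimes> inv x = group_commutator G x y \<otimes> y"
  using assms by (simp add: group_commutator_def free_reduce)

lemma Hall_Witt:
  assumes "x \<in> carrier G" "y \<in> carrier G" "z \<in> carrier G"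
  shows "group_commutator G (group_commutator G x y) (y \<otimes> z \<otimes> inv y)
       \<otimes> (group_commutator G (group_commutator G y z) (z \<otimes> x \<otimes> inv z)
       \<otimes> group_commutator G (group_commutator G z x) (x \<otimes> y \<otimes> inv x)) = \<one>"
  using assms by (simp add: group_commutator_def free_reduce)

lemma lower_central_series_Suc:
  assumes "0 < i"
  shows "lower_central_series G (Suc i) = generate G
     {group_commutator G x y | x y. x \<in> carrier G \<and> y \<in> lower_central_series G i}"
  using assms by (simp add: lower_central_series.simps(2) commutator_subgroup_def group_commutator_def)

lemma lower_central_series_normal: "lower_central_series G i \<lhd> G"
proof (induction i)
  case 0
  then show ?case by (simp add: normal_inv_iff subgroup_self)
next
  case (Suc i)
  show ?case
  proof (cases "i = 0")
    case True
    then show ?thesis by (simp add: normal_inv_iff subgroup_self)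
  next
    case False
    interpret N: normal "lower_central_series G i" G by (rule Suc.IH)
    show ?thesis
      unfolding lower_central_series_Suc[OF False[simplified]]
    proof (rule normal_generateI)
      show "{group_commutator G x y |x y. x \<in> carrier G \<and> y \<in> lower_central_series G i} \<subseteq> carrier G"
        using N.subset by auto
    next
      fix h g assume "h \<in> {group_commutator G x y |x y. x \<in> carrier G \<and> y \<in> lower_central_series G i}"
        and g: "g \<in> carrier G"
      then obtain x y where xy: "x \<in> carrier G" "y \<in> lower_central_series G i" "h = group_commutator G x y"
        by auto
      have "g \<otimes> h \<otimes> inv g = group_commutator G (g \<otimes> x \<otimes> inv g) (g \<otimes> y \<otimes> inv g)"
        using xy g N.subset[THEN subsetD, OF xy(2)] by (simp add: group_commutator_def free_reduce)
      moreover have "g \<otimes> y \<otimes> inv g \<in> lower_central_series G i"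
        using xy g by (simp add: N.inv_op_closed2)
      ultimately show "g \<otimes> h \<otimes> inv g \<in> {group_commutator G x y |x y. x \<in> carrier G \<and> y \<in> lower_central_series G i}"
        using g xy by (metis (mono_tags, lifting) inv_closed m_closed mem_Collect_eq)
    qed
  qed
qed

text \<open>
  The proof is by induction on \<open>i\<close>. It suffices to treat \<open>x = [g, u]\<close> with \<open>u\<close> in
  the \<open>i\<close>-th term, because the elements whose commutators with the \<open>j\<close>-th term land in the normal
  subgroup on the right form a subgroup. For such \<open>x\<close>, the Hall-Witt identity exchanges
  \<open>[[g, u], v]\<close> for commutators of \<open>[z, g]\<close> with the \<open>i\<close>-th term and of \<open>[u, z]\<close> with \<open>G\<close>; the
  induction hypothesis covers both.
\<close>

lemma lower_central_series_commutator:
  assumes "x \<in> lower_central_series G i" "y \<in> lower_central_series G j"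
  shows "group_commutator G x y \<in> lower_central_series G (i + j)"
  using assms
proof (induction i arbitrary: x y j)
  case 0
  interpret N: normal "lower_central_series G j" G by (rule lower_central_series_normal)
  from 0 have "x \<otimes> y \<otimes> inv x \<in> lower_central_series G j" by (simp add: N.inv_op_closed2)
  then show ?case using 0 by (simp add: group_commutator_def)
next
  case (Suc i)
  let ?L = "lower_central_series G"
  have closed: "a \<in> carrier G" if "a \<in> ?L m" for a m
    by (rule subgroup.mem_carrier[OF normal_imp_subgroup[OF lower_central_series_normal] that])
  have base: "group_commutator G a b \<in> ?L (Suc m)" if "a \<in> carrier G" "b \<in> ?L m" for a b m
  proof (cases "m = 0")
    case True
    then show ?thesis using that by simp
  next
    case False
    have "group_commutator G a b \<in> generate G {group_commutator G x y | x y. x \<in> carrier G \<and> y \<in> ?L m}"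
      by (rule generate.incl) (use that in auto)
    then show ?thesis using False by (simp only: lower_central_series_Suc)
  qed
  show ?case
  proof (cases "i = 0")
    case True
    then show ?thesis using base[of x y j] Suc.prems by simp
  next
    case False
    interpret N: normal "?L (Suc i + j)" G by (rule lower_central_series_normal)
    interpret J: normal "?L j" G by (rule lower_central_series_normal)
    interpret I: normal "?L i" G by (rule lower_central_series_normal)
    have swap: "group_commutator G a b \<in> ?L (Suc i + j)"
      if "group_commutator G b a \<in> ?L (Suc i + j)" "a \<in> carrier G" "b \<in> carrier G" for a b
      using N.m_inv_closed[OF that(1)] unfolding inv_group_commutator[OF that(3,2)] .
    have gen: "group_commutator G (group_commutator G g u) v \<in> ?L (Suc i + j)"
      if g: "g \<in> carrier G" and u: "u \<in> ?L i" and v: "v \<in> ?L j" for g u v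
    proof -
      \<comment> \<open>The conjugate of \<open>v\<close> for which the first factor of the Hall-Witt identity is \<open>[[g, u], v]\<close>.\<close>
      define z where "z = inv u \<otimes> v \<otimes> u"
      have c: "u \<in> carrier G" "v \<in> carrier G" using closed[OF u] closed[OF v] by auto
      have z: "z \<in> ?L j" unfolding z_def using c v by (simp add: J.inv_op_closed1)
      have zc: "z \<in> carrier G" by (rule closed[OF z])
      have "g \<otimes> u \<otimes> inv g \<in> ?L i" using c u g by (simp add: I.inv_op_closed2)
      moreover have "group_commutator G g z \<in> ?L (Suc j)" using base[OF g z] .
      ultimately have "group_commutator G (g \<otimes> u \<otimes> inv g) (inv (group_commutator G g z)) \<in> ?L (i + Suc j)"
        by (intro Suc.IH subgroup.m_inv_closed[OF normal_imp_subgroup[OF lower_central_series_normal]])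
      then have 1: "group_commutator G (group_commutator G z g) (g \<otimes> u \<otimes> inv g) \<in> ?L (Suc i + j)"
        using swap c g zc by (simp add: inv_group_commutator)
      have "group_commutator G (z \<otimes> g \<otimes> inv z) (group_commutator G u z) \<in> ?L (Suc (i + j))"
        using Suc.IH[OF u z] g c zc by (intro base) simp_all
      then have 2: "group_commutator G (group_commutator G u z) (z \<otimes> g \<otimes> inv z) \<in> ?L (Suc i + j)"
        using swap c g zc by simp
      let ?r = "group_commutator G (group_commutator G u z) (z \<otimes> g \<otimes> inv z)
         \<otimes> group_commutator G (group_commutator G z g) (g \<otimes> u \<otimes> inv g)"
      have "u \<otimes> z \<otimes> inv u = v" using c by (simp add: z_def free_reduce)
      with Hall_Witt[OF g c(1) zc]
      have "group_commutator G (group_commutator G g u) v \<otimes> ?r = \<one>"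
        by simp
      then have "group_commutator G (group_commutator G g u) v = inv ?r"
        using g c zc by (intro inv_equality [symmetric]) simp_all
      also have "\<dots> \<in> ?L (Suc i + j)"
        using 1 2 by (intro N.m_inv_closed N.m_closed)
      finally show ?thesis .
    qed
    have "x \<in> generate G {group_commutator G g u | g u. g \<in> carrier G \<and> u \<in> ?L i}"
      using Suc.prems(1) False by (simp only: lower_central_series_Suc)
    then have "x \<in> carrier G \<and> group_commutator G x y \<in> ?L (Suc i + j)"
    proof (induction rule: generate.induct)
      case one
      then show ?case using closed[OF Suc.prems(2)] N.one_closed by (simp add: group_commutator_def)
    next
      case (incl h)
      then obtain g u where h: "h = group_commutator G g u" "g \<in> carrier G" "u \<in> ?L i" by auto
      then show ?case using gen[OF h(2,3) Suc.prems(2)] closed[OF h(3)] by simp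
    next
      case (inv h)
      then obtain g u where h: "h = group_commutator G g u" "g \<in> carrier G" "u \<in> ?L i" by auto
      have y: "y \<in> carrier G" by (rule closed[OF Suc.prems(2)])
      have hc: "h \<in> carrier G" using h closed[OF h(3)] by simp
      have "group_commutator G y h \<in> ?L (Suc i + j)"
        by (rule swap) (use gen[OF h(2,3) Suc.prems(2)] h(1) hc y in auto)
      then show ?case using hc y by (simp only: group_commutator_inv_left N.inv_op_closed1 inv_closed)
    next
      case (eng h1 h2)
      have y: "y \<in> carrier G" by (rule closed[OF Suc.prems(2)])
      with eng show ?case
        by (simp only: group_commutator_mult_left N.m_closed N.inv_op_closed2 m_closed)
    qed
    then show ?thesis by simp
  qed
qed

lemma lower_central_series_decreasing:
  "lower_central_series G (Suc i) \<subseteq> lower_central_series G i"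
proof (cases "i = 0")
  case False
  interpret N: normal "lower_central_series G i" G by (rule lower_central_series_normal)
  have "group_commutator G x y \<in> lower_central_series G i"
    if "x \<in> carrier G" "y \<in> lower_central_series G i" for x y
    using lower_central_series_commutator[of x 0 y i] that by simp
  then show ?thesis
    unfolding lower_central_series_Suc[OF False[simplified]]
    by (intro generate_subgroup_incl N.subgroup_axioms) auto
qed simp

end

section \<open>Polynomial sequences in filtered groups\<close>

locale filtered_group = group G for G (structure) +
  fixes F :: "nat \<Rightarrow> 'a set"
  assumes subgroup_F: "subgroup (F i) G"
    and F_Suc: "F (Suc i) \<subseteq> F i"
    and commutator_F: "x \<in> F i \<Longrightarrow> y \<in> F j \<Longrightarrow> group_commutator G x y \<in> F (i + j)"
begin

lemma F_carrier: "x \<in> F i \<Longrightarrow> x \<in> carrier G"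
  by (rule subgroup.mem_carrier[OF subgroup_F])

lemma F_mono: "i \<le> j \<Longrightarrow> F j \<subseteq> F i"
  by (rule lift_Suc_antimono_le[where f = F]) (rule F_Suc)

lemma conj_F:
  assumes "g \<in> F 0" "x \<in> F i"
  shows "g \<otimes> x \<otimes> inv g \<in> F i"
proof -
  have "g \<otimes> x \<otimes> inv g = group_commutator G g x \<otimes> x"
    using assms by (intro conj_eq_group_commutator_mult F_carrier)
  then show ?thesis
    using subgroup.m_closed[OF subgroup_F commutator_F[OF assms, simplified] assms(2)] by simp
qed

text \<open>
  Passing to the elements whose \<open>T\<close>-difference lies one level further down preserves the axioms of a
  filtration. For products this uses that \<open>F 0\<close> normalizes each term. For commutators, put
  \<open>T f = a f\<close> and \<open>T g = b g\<close>; modulo level \<open>i + j + 1\<close> the element \<open>a\<close> commutes with \<open>b\<close> and \<open>g\<close>,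
  the element \<open>b\<close> commutes with \<open>f\<close>, and both commute with \<open>[f, g]\<close>, so \<open>[a f, b g]\<close> and \<open>[f, g]\<close>
  agree there. In the group of sequences with \<open>T\<close> the shift, iterating this statement yields
  the theorem of Lazard and Leibman that polynomial sequences form a group.
\<close>

lemma derived_filtered_group:
  assumes T: "T \<in> hom G G" and TF: "\<And>i x. x \<in> F i \<Longrightarrow> T x \<in> F i"
  defines "D \<equiv> \<lambda>i. {f \<in> F i. T f \<otimes> inv f \<in> F (Suc i)}"
  shows "filtered_group G D"
    and "(\<And>i x. x \<in> D i \<Longrightarrow> T x \<in> D i)"
proof -
  interpret T: group_hom G G T
    using T by (simp add: group_hom_def group_hom_axioms_def group_axioms)
  have Di: "f \<in> F i" "T f \<otimes> inv f \<in> F (Suc i)" "f \<in> carrier G" if "f \<in> D i" for f i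
    using that by (auto simp: D_def intro: F_carrier)
  have F0: "x \<in> F 0" if "x \<in> F i" for x i
    using F_mono[of 0 i] that by blast
  show "filtered_group G D"
  proof (intro filtered_group.intro filtered_group_axioms.intro group_axioms)
    fix i
    interpret S: subgroup "F i" G by (rule subgroup_F)
    interpret S': subgroup "F (Suc i)" G by (rule subgroup_F)
    show "subgroup (D i) G"
    proof (rule subgroupI)
      show "D i \<subseteq> carrier G" using Di by auto
      have "\<one> \<in> D i" by (simp add: D_def)
      then show "D i \<noteq> {}" by auto
    next
      fix f assume f: "f \<in> D i"
      have "T (inv f) \<otimes> inv (inv f) = inv f \<otimes> inv (T f \<otimes> inv f) \<otimes> inv (inv f)"
        using Di[OF f] by (simp add: free_reduce)
      moreover have "\<dots> \<in> F (Suc i)" 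
        by (intro conj_F S'.m_inv_closed F0[OF S.m_inv_closed] Di[OF f])
      ultimately show "inv f \<in> D i" using Di[OF f] by (simp add: D_def)
    next
      fix f g assume f: "f \<in> D i" and g: "g \<in> D i"
      have "T (f \<otimes> g) \<otimes> inv (f \<otimes> g) = (T f \<otimes> inv f) \<otimes> (f \<otimes> (T g \<otimes> inv g) \<otimes> inv f)"
        using Di[OF f] Di[OF g] by (simp add: free_reduce)
      moreover have "f \<otimes> (T g \<otimes> inv g) \<otimes> inv f \<in> F (Suc i)"
        by (intro conj_F Di(2)[OF g] F0[OF Di(1)[OF f]])
      ultimately show "f \<otimes> g \<in> D i"
        using Di[OF f] Di[OF g] unfolding D_def by (metis (mono_tags, lifting) S'.m_closed S.m_closed mem_Collect_eq)
    qed
    show "D (Suc i) \<subseteq> D i"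
      using F_Suc by (auto simp: D_def)
  next
    fix f g i j assume f: "f \<in> D i" and g: "g \<in> D j"
    define a where "a = T f \<otimes> inv f"
    define b where "b = T g \<otimes> inv g"
    note fi = Di[OF f, folded a_def] and gj = Di[OF g, folded b_def]
    have c: "a \<in> carrier G" "b \<in> carrier G" using fi gj F_carrier by auto
    have Tf: "T f = a \<otimes> f" "T g = b \<otimes> g"
      using fi gj by (simp_all add: a_def b_def free_reduce)
    interpret N: subgroup "F (Suc (i + j))" G by (rule subgroup_F)
    define h where "h = group_commutator G f g"
    have hF: "h \<in> F (i + j)" unfolding h_def by (rule commutator_F) (use fi gj in auto)
    have hc: "h \<in> carrier G" using hF F_carrier by auto
    have le: "F k \<subseteq> F (Suc (i + j))" if "Suc (i + j) \<le> k" for k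
      by (rule F_mono[OF that])
    have Th: "T h \<in> carrier G" and Th_eq: "T h = group_commutator G (a \<otimes> f) (b \<otimes> g)"
      using hc fi gj c by (simp_all add: h_def group_commutator_def Tf)
    \<comment> \<open>A word identity in \<open>a, b, f, g\<close> that exhibits the difference as a product of conjugates of the
      five commutators lying in \<open>F (Suc (i + j))\<close>.\<close>
    have "T h \<otimes> inv h
       = (a \<otimes> group_commutator G f b \<otimes> inv a)
         \<otimes> (a \<otimes> group_commutator G b h \<otimes> inv a) \<otimes> group_commutator G a h
         \<otimes> (h \<otimes> (group_commutator G a b \<otimes> (b \<otimes> group_commutator G a g \<otimes> inv b)) \<otimes> inv h)"
      unfolding Th_eq by (simp add: h_def group_commutator_def free_reduce fi gj c)
    moreover have "group_commutator G f b \<in> F (Suc (i + j))" "group_commutator G a g \<in> F (Suc (i + j))"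
      using commutator_F[OF fi(1) gj(2)] commutator_F[OF fi(2) gj(1)] by simp_all
    moreover have "group_commutator G b h \<in> F (Suc (i + j))" "group_commutator G a h \<in> F (Suc (i + j))"
      "group_commutator G a b \<in> F (Suc (i + j))"
      using subsetD[OF le commutator_F[OF gj(2) hF]] subsetD[OF le commutator_F[OF fi(2) hF]]
        subsetD[OF le commutator_F[OF fi(2) gj(2)]] by simp_all
    moreover have "a \<in> F 0" "b \<in> F 0" "h \<in> F 0"
      using fi gj hF F0 by blast+
    ultimately have "T h \<otimes> inv h \<in> F (Suc (i + j))"
      by (simp only: N.m_closed conj_F)
    then show "group_commutator G f g \<in> D (i + j)"
      using hF by (simp add: D_def h_def)
  qed
  fix i x assume x: "x \<in> D i"
  have "T (T x) \<otimes> inv (T x) = T (T x \<otimes> inv x)"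
    using Di[OF x] by simp
  then show "T x \<in> D i"
    using TF[OF Di(1)[OF x]] TF[OF Di(2)[OF x]] by (simp add: D_def)
qed

end

text \<open>
  Membership means that for every \<open>j \<le> k\<close> the \<open>j\<close>-th iterated difference takes its values
  in \<open>F (i + j)\<close>. Bounding the number of differences by \<open>k\<close> makes each step of the recursion one
  instance of the construction in \<open>derived_filtered_group\<close>.
\<close>

primrec polynomial_sequences :: "('a, 'b) monoid_scheme \<Rightarrow> (nat \<Rightarrow> 'a set) \<Rightarrow> nat \<Rightarrow> nat \<Rightarrow> (nat \<Rightarrow> 'a) set"
  where
    "polynomial_sequences G F 0 i = {f. \<forall>n. f n \<in> F i}"
  | "polynomial_sequences G F (Suc k) i =
       {f \<in> polynomial_sequences G F k i.
          (\<lambda>n. f (Suc n) \<otimes>\<^bsub>G\<^esub> inv\<^bsub>G\<^esub> f n) \<in> polynomial_sequences G F k (Suc i)}"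

context filtered_group
begin

abbreviation sequence_group :: "(nat \<Rightarrow> 'a) monoid" where
  "sequence_group \<equiv> product_group UNIV (\<lambda>_. G)"

lemma sequence_group_inv:
  assumes "f \<in> carrier sequence_group"
  shows "inv\<^bsub>sequence_group\<^esub> f = (\<lambda>n. inv f n)"
  using assms by (simp add: group_axioms restrict_UNIV)

lemma polynomial_sequences_filtered_group:
  "filtered_group sequence_group (polynomial_sequences G F k)"
  and polynomial_sequences_shift:
  "f \<in> polynomial_sequences G F k i \<Longrightarrow> (\<lambda>n. f (Suc n)) \<in> polynomial_sequences G F k i"
proof (induction k arbitrary: f i)
  case 0
  {
    case 1
    interpret W: group sequence_group
      by (simp add: group_axioms)
    show ?case
    proof (intro filtered_group.intro filtered_group_axioms.intro W.group_axioms)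
      fix i
      have "PiE UNIV (\<lambda>_. F i) = polynomial_sequences G F 0 i"
        by auto
      moreover have "subgroup (PiE UNIV (\<lambda>_. F i)) sequence_group"
        by (subst PiE_subgroup_product_group) (simp_all add: group_axioms subgroup_F)
      ultimately show "subgroup (polynomial_sequences G F 0 i) sequence_group"
        by simp
    next
      fix f g i j assume "f \<in> polynomial_sequences G F 0 i" "g \<in> polynomial_sequences G F 0 j"
      then have fg: "\<And>n. f n \<in> F i" "\<And>n. g n \<in> F j" by auto
      then have "group_commutator sequence_group f g = (\<lambda>n. group_commutator G (f n) (g n))"
        unfolding group_commutator_def
        by (subst (1 2) inv_product_group) (auto simp: group_axioms PiE_iff intro: F_carrier)
      then show "group_commutator sequence_group f g \<in> polynomial_sequences G F 0 (i + j)"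
        using fg commutator_F by simp
    qed (use F_Suc in auto)
  next
    case 2
    then show ?case by simp
  }
next
  case (Suc k)
  interpret P: filtered_group sequence_group "polynomial_sequences G F k"
    by (rule Suc.IH)
  have T: "(\<lambda>f n. f (Suc n)) \<in> hom sequence_group sequence_group"
    by (auto simp: hom_def)
  have D: "polynomial_sequences G F (Suc k) i = {f \<in> polynomial_sequences G F k i.
      (\<lambda>n. f (Suc n)) \<otimes>\<^bsub>sequence_group\<^esub> inv\<^bsub>sequence_group\<^esub> f \<in> polynomial_sequences G F k (Suc i)}" for i
  proof -
    have "(\<lambda>n. f (Suc n)) \<otimes>\<^bsub>sequence_group\<^esub> inv\<^bsub>sequence_group\<^esub> f
       = (\<lambda>n. f (Suc n) \<otimes>\<^bsub>G\<^esub> inv\<^bsub>G\<^esub> f n)" if "f \<in> polynomial_sequences G F k i" for f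
      unfolding sequence_group_inv[OF P.F_carrier[OF that]] by (simp add: restrict_UNIV)
    then show ?thesis by auto
  qed
  {
    case 1
    show ?case
      using P.derived_filtered_group(1)[OF T Suc.IH(2), folded D] by simp
  next
    case 2
    then show ?case
      using P.derived_filtered_group(2)[OF T Suc.IH(2), folded D] by blast
  }
qed

lemma polynomial_sequences_one: "(\<lambda>_. \<one>) \<in> polynomial_sequences G F k i"
proof -
  interpret P: filtered_group sequence_group "polynomial_sequences G F k"
    by (rule polynomial_sequences_filtered_group)
  show ?thesis using subgroup.one_closed[OF P.subgroup_F, of i] by (simp add: restrict_UNIV)
qed

lemma polynomial_sequences_mult:
  assumes "f \<in> polynomial_sequences G F k i" "g \<in> polynomial_sequences G F k i"
  shows "(\<lambda>n. f n \<otimes> g n) \<in> polynomial_sequences G F k i"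
proof -
  interpret P: filtered_group sequence_group "polynomial_sequences G F k"
    by (rule polynomial_sequences_filtered_group)
  show ?thesis using subgroup.m_closed[OF P.subgroup_F assms] by (simp add: restrict_UNIV)
qed

lemma polynomial_sequences_value:
  "f \<in> polynomial_sequences G F k i \<Longrightarrow> f n \<in> F i"
  by (induction k) auto

lemma polynomial_sequences_binomial:
  assumes "g \<in> F (i + j)"
  shows "(\<lambda>n. g [^] (n choose j)) \<in> polynomial_sequences G F k i"
  using assms
proof (induction k arbitrary: i j)
  case 0
  have "g \<in> F i" using F_mono[of i "i + j"] 0 by auto
  moreover have "h [^] m \<in> F i" if "h \<in> F i" for h and m :: nat
    using that subgroup_F[of i] by (induction m) (auto simp: subgroup.one_closed subgroup.m_closed)
  ultimately show ?case by simp
next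
  case (Suc k)
  have gc: "g \<in> carrier G" using Suc.prems by (rule F_carrier)
  show ?case
  proof (cases j)
    case 0
    then show ?thesis using Suc.IH[of i 0] Suc.prems polynomial_sequences_one gc by simp
  next
    case (Suc j')
    have "(\<lambda>n. g [^] (Suc n choose j) \<otimes> inv (g [^] (n choose j))) = (\<lambda>n. g [^] (n choose j'))"
      using gc by (simp add: Suc m_assoc flip: nat_pow_mult)
    then show ?thesis using Suc.IH[of i j] Suc.IH[of "Suc i" j'] Suc.prems Suc by simp
  qed
qed

text \<open>
  If \<open>f\<close> is trivial before \<open>j\<close>, then so are its first differences before \<open>j - 1\<close>, and after \<open>j\<close>
  steps the \<open>j\<close>-th difference at \<open>0\<close> is \<open>f j\<close> itself.
\<close>

lemma polynomial_sequences_first_value: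
  assumes "f \<in> polynomial_sequences G F k i" "j \<le> k" "\<And>m. m < j \<Longrightarrow> f m = \<one>"
  shows "f j \<in> F (i + j)"
  using assms
proof (induction j arbitrary: f k i)
  case 0
  then show ?case using polynomial_sequences_value by force
next
  case (Suc j)
  then obtain k' where k: "k = Suc k'" by (cases k) auto
  define h where "h = (\<lambda>n. f (Suc n) \<otimes> inv f n)"
  have "h \<in> polynomial_sequences G F k' (Suc i)" using Suc.prems k by (simp add: h_def)
  then have "h j \<in> F (Suc i + j)"
    by (rule Suc.IH) (use Suc.prems k in \<open>auto simp: h_def\<close>)
  moreover have "f (Suc j) \<in> carrier G"
    using polynomial_sequences_value[OF Suc.prems(1)] F_carrier by blast
  ultimately show ?case using Suc.prems(3)[of j] by (simp add: h_def)
qed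

text \<open>
  This is Taylor expansion. The first value \<open>z = f j\<close> that may be nontrivial lies in \<open>F j\<close>;
  multiplying \<open>f\<close> by the inverse of \<open>z\<close> to the power \<open>m choose j\<close> removes it and leaves the earlier
  values alone. At \<open>m = n\<close> this factor is trivial by hypothesis, so the value at \<open>n\<close> never changes,
  while the range on which the sequence is known to be trivial grows until it contains \<open>n\<close>.
\<close>

lemma polynomial_sequence_vanishes:
  assumes "f \<in> polynomial_sequences G F n 0"
    and "\<And>m. m < j \<Longrightarrow> f m = \<one>"
    and "\<And>i z. j \<le> i \<Longrightarrow> z \<in> F i \<Longrightarrow> z [^] (n choose i) = \<one>"
  shows "f n = \<one>"
  using assms
proof (induction "Suc n - j" arbitrary: f j)
  case 0
  then show ?case by simp
next
  case (Suc d)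
  then have "j \<le> n" by simp
  define z where "z = f j"
  have z: "z \<in> F j"
    using polynomial_sequences_first_value[OF Suc.prems(1) \<open>j \<le> n\<close> Suc.prems(2)] by (simp add: z_def)
  have zc: "z \<in> carrier G" using z by (rule F_carrier)
  define h where "h = (\<lambda>m. inv z [^] (m choose j) \<otimes> f m)"
  have fc: "f m \<in> carrier G" for m
    using polynomial_sequences_value[OF Suc.prems(1)] F_carrier by blast
  have "h n = \<one>"
  proof (rule Suc.hyps)
    show "d = Suc n - Suc j" using Suc.hyps by simp
    show "h \<in> polynomial_sequences G F n 0"
      unfolding h_def using z subgroup_F[of j]
      by (intro polynomial_sequences_mult polynomial_sequences_binomial Suc.prems)
        (simp add: subgroup.m_inv_closed)
    show "h m = \<one>" if "m < Suc j" for m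
    proof (cases "m = j")
      case True
      then show ?thesis using zc by (simp add: h_def z_def[symmetric])
    next
      case False
      then have "m < j" using that by simp
      then show ?thesis using Suc.prems(2)[of m] by (simp add: h_def binomial_eq_0)
    qed
    show "\<And>i z. Suc j \<le> i \<Longrightarrow> z \<in> F i \<Longrightarrow> z [^] (n choose i) = \<one>"
      using Suc.prems(3) by simp
  qed
  moreover have "inv z [^] (n choose j) = \<one>"
    using Suc.prems(3)[of j "inv z"] z subgroup_F[of j] by (simp add: subgroup.m_inv_closed)
  ultimately show ?case using fc by (simp add: h_def)
qed

text \<open>
  The sequence \<open>f m\<close> obtained by multiplying \<open>y\<close> to the power \<open>-m\<close>, \<open>x\<close> to the power \<open>-m\<close> and
  \<open>x \<otimes> y\<close> to the power \<open>m\<close> is polynomial and trivial at \<open>0\<close> and \<open>1\<close>. Its second Taylor coefficient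
  is \<open>f 2 = e\<close>, and the hypothesis on \<open>n\<close> kills all later ones, so \<open>f n\<close> is \<open>e\<close>
  to the power \<open>n choose 2\<close>.
\<close>

lemma Hall_formula:
  assumes x: "x \<in> F 1" and y: "y \<in> F 1"
    and kill: "\<And>i z. 3 \<le> i \<Longrightarrow> z \<in> F i \<Longrightarrow> z [^] (n choose i) = \<one>"
  defines "e \<equiv> inv y \<otimes> group_commutator G (inv y) (inv x) \<otimes> y"
  shows "(x \<otimes> y) [^] n = x [^] n \<otimes> y [^] n \<otimes> e [^] (n choose 2)"
proof -
  have c: "x \<in> carrier G" "y \<in> carrier G" using x y F_carrier by blast+
  \<comment> \<open>The exponent \<open>m choose 1\<close> makes each factor an instance of \<open>polynomial_sequences_binomial\<close>.\<close>
  define f where "f = (\<lambda>m. inv y [^] (m choose 1) \<otimes> inv x [^] (m choose 1) \<otimes> (x \<otimes> y) [^] (m choose 1))"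
  have f2: "f 2 = e"
    using c by (simp add: f_def e_def group_commutator_def numeral_2_eq_2 free_reduce)
  have f01: "f 0 = \<one>" "f 1 = \<one>"
    using c by (simp_all add: f_def free_reduce)
  have f: "f \<in> polynomial_sequences G F k 0" for k
    unfolding f_def using x y subgroup_F[of 1]
    by (intro polynomial_sequences_mult polynomial_sequences_binomial)
      (simp_all add: subgroup.m_inv_closed subgroup.m_closed)
  have e: "e \<in> F 2"
    using polynomial_sequences_first_value[OF f[of 2], of 2] f01 f2
    by (metis One_nat_def add_0 le_refl less_2_cases)
  have ec: "e \<in> carrier G" using e by (rule F_carrier)
  define h where "h = (\<lambda>m. inv e [^] (m choose 2) \<otimes> f m)"
  have "h n = \<one>"
  proof (rule polynomial_sequence_vanishes[where j = 3])
    show "h \<in> polynomial_sequences G F n 0"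
      unfolding h_def using e subgroup_F[of 2]
      by (intro polynomial_sequences_mult polynomial_sequences_binomial f) (simp only: add_0 subgroup.m_inv_closed)
    show "h m = \<one>" if "m < 3" for m
    proof -
      have "m = 0 \<or> m = 1 \<or> m = 2" using that by auto
      then show ?thesis using f01 f2 ec by (auto simp: h_def binomial_eq_0)
    qed
  qed (use kill in auto)
  then have "f n = e [^] (n choose 2)"
    using ec c unfolding h_def
    by (simp add: nat_pow_inv f_def inv_solve_left')
  moreover have "f n = inv (y [^] n) \<otimes> (inv (x [^] n) \<otimes> (x \<otimes> y) [^] n)"
    using c by (simp add: f_def nat_pow_inv m_assoc)
  ultimately have "x [^] n \<otimes> y [^] n \<otimes> e [^] (n choose 2) = 
    x [^] n \<otimes> (y [^] n \<otimes> (inv (y [^] n) \<otimes> (inv (x [^] n) \<otimes> (x \<otimes> y) [^] n)))"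
    using c ec by (simp add: m_assoc)
  also have "\<dots> = (x \<otimes> y) [^] n"
    using c by (simp only: mult_inv_cancel_left inv_closed nat_pow_closed m_closed)
  finally show ?thesis by simp
qed

end

section \<open>Powers in groups of class less than p\<close>

text \<open>
  Apart from the factor \<open>i * (i - 1)\<close>, which is prime to \<open>p\<close>, the binomial coefficient is a
  multiple of \<open>n * (n - 1)\<close>.
\<close>

lemma prime_power_dvd_choose:
  fixes p n i t :: nat
  assumes p: "Factorial_Ring.prime p" and i: "2 \<le> i" "i < p" and dvd: "p ^ t dvd n * (n - 1)"
  shows "p ^ t dvd n choose i"
proof -
  have "i * (i - 1) * (n choose i) = (i - 1) * (i * (n choose i))"
    by simp
  also have "i * (n choose i) = n * ((n - 1) choose (i - 1))"
    using i by (intro times_binomial_minus1_eq) simp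
  also have "(i - 1) * (n * ((n - 1) choose (i - 1))) = n * ((i - 1) * ((n - 1) choose (i - 1)))"
    by simp
  also have "(i - 1) * ((n - 1) choose (i - 1)) = (n - 1) * ((n - 1 - 1) choose (i - 1 - 1))"
    using i by (intro times_binomial_minus1_eq) simp
  finally have eq: "i * (i - 1) * (n choose i) = n * (n - 1) * ((n - 2) choose (i - 2))"
    by (simp add: numeral_2_eq_2)
  have "\<not> p dvd i" "\<not> p dvd i - 1"
    using i by (auto dest!: dvd_imp_le)
  then have "coprime (p ^ t) (i * (i - 1))"
    using p by (simp add: prime_imp_coprime)
  moreover have "p ^ t dvd i * (i - 1) * (n choose i)"
    unfolding eq using dvd by simp
  ultimately show ?thesis
    using coprime_dvd_mult_right_iff by blast
qed

context group
begin

lemma lower_central_series_filtered_group: "filtered_group G (lower_central_series G)"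
  by (intro filtered_group.intro filtered_group_axioms.intro group_axioms normal_imp_subgroup
      lower_central_series_normal lower_central_series_decreasing lower_central_series_commutator)

lemma pow_eq_one_if_dvd:
  assumes "x \<in> carrier G" "x [^] (q :: nat) = \<one>" "q dvd n"
  shows "x [^] n = \<one>"
  using assms by (auto simp: dvd_def simp flip: nat_pow_pow)

lemma conj_nat_pow:
  assumes "g \<in> carrier G" "x \<in> carrier G"
  shows "(g \<otimes> x \<otimes> inv g) [^] (n :: nat) = g \<otimes> x [^] n \<otimes> inv g"
  using assms by (induction n) (simp_all add: free_reduce)

end

text \<open>
  These assumptions make Hall's formula collapse: if \<open>p ^ t\<close> divides \<open>n * (n - 1)\<close> and \<open>i \<ge> 2\<close>, then
  the exponent \<open>n choose i\<close> kills every term of the series whose index is at least \<open>3\<close> and at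
  least \<open>i\<close>.
\<close>

locale small_class_group = group G for G (structure) +
  fixes p t :: nat
  assumes p: "Factorial_Ring.prime p" "odd p"
    and class_less: "lower_central_series G p = {\<one>}"
    and exponent: "z \<in> lower_central_series G 3 \<Longrightarrow> z [^] (p ^ t) = \<one>"
begin

abbreviation L :: "nat \<Rightarrow> 'a set" where "L \<equiv> lower_central_series G"

sublocale L: filtered_group G L
  by (rule lower_central_series_filtered_group)

lemma conj_L: "x \<in> L i \<Longrightarrow> g \<in> carrier G \<Longrightarrow> g \<otimes> x \<otimes> inv g \<in> L i"
  using L.conj_F by simp

lemma conj_inv_L: "x \<in> L i \<Longrightarrow> g \<in> carrier G \<Longrightarrow> inv g \<otimes> x \<otimes> g \<in> L i"
  using conj_L[of x i "inv g"] by simp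

lemma inv_L: "x \<in> L i \<Longrightarrow> inv x \<in> L i"
  by (rule subgroup.m_inv_closed[OF L.subgroup_F])

lemma p_ge_3: "3 \<le> p"
proof -
  have "2 \<le> p" "p \<noteq> 2" using p prime_ge_2_nat by auto
  then show ?thesis by simp
qed

lemma pow_choose_eq_one:
  assumes "p ^ t dvd n * (n - 1)" "2 \<le> i" "3 \<le> j" "i \<le> j" "z \<in> L j"
  shows "z [^] (n choose i) = \<one>"
proof (cases "i < p")
  case True
  have "z \<in> L 3" using assms L.F_mono[of 3 j] by auto
  then show ?thesis
    using exponent prime_power_dvd_choose[OF p(1) assms(2) True assms(1)]
      pow_eq_one_if_dvd L.F_carrier[OF assms(5)] by blast
next
  case False
  then have "z \<in> L p" using assms L.F_mono[of p j] by auto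
  then show ?thesis using class_less by simp
qed

lemma commutator_L2: "x \<in> carrier G \<Longrightarrow> y \<in> carrier G \<Longrightarrow> group_commutator G x y \<in> L 2"
  using L.commutator_F[of x 1 y 1] by (simp add: numeral_2_eq_2)

lemma commutator_L3:
  "x \<in> L 2 \<Longrightarrow> y \<in> carrier G \<Longrightarrow> group_commutator G x y \<in> L 3"
  "y \<in> carrier G \<Longrightarrow> x \<in> L 2 \<Longrightarrow> group_commutator G y x \<in> L 3"
  using L.commutator_F[of x 2 y 1] L.commutator_F[of y 1 x 2] by (simp_all add: numeral_3_eq_3)

text \<open>
  With one factor in the derived subgroup the correction term \<open>e\<close> of Hall's formula lies in the
  third term of the series, and its exponent is a multiple of \<open>p ^ t\<close>.
\<close>

lemma pow_mult_L2:
  assumes n: "p ^ t dvd n * (n - 1)" and y: "y \<in> carrier G" and u: "u \<in> L 2"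
  shows "(y \<otimes> u) [^] n = y [^] n \<otimes> u [^] n"
proof -
  have uc: "u \<in> carrier G" using u by (rule L.F_carrier)
  define e where "e = inv u \<otimes> group_commutator G (inv u) (inv y) \<otimes> u"
  have "(y \<otimes> u) [^] n = y [^] n \<otimes> u [^] n \<otimes> e [^] (n choose 2)"
    unfolding e_def by (rule L.Hall_formula) (use y uc pow_choose_eq_one[OF n] in auto)
  moreover have "e \<in> L 3"
    unfolding e_def using y u uc by (intro conj_inv_L commutator_L3 inv_L) auto
  then have "e [^] (n choose 2) = \<one>"
    using pow_choose_eq_one[OF n, of 2 3] by simp
  ultimately show ?thesis using y uc by simp
qed

lemma dvd_imp_dvd_mult_pred: "p ^ t dvd N \<Longrightarrow> p ^ t dvd N * (N - 1)"
  by simp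

lemma L3_pow: "p ^ t dvd N \<Longrightarrow> z \<in> L 3 \<Longrightarrow> z [^] N = \<one>"
  using exponent pow_eq_one_if_dvd L.F_carrier by blast

text \<open>
  Conjugation changes \<open>u\<close> by an element of the third term, which the \<open>N\<close>-th power cannot see. As a
  consequence, \<open>N\<close>-th powers of commutators are central, and \<open>[x, y]\<close> to the power \<open>N\<close> is
  multiplicative in \<open>x\<close> and in \<open>y\<close>.
\<close>

lemma conj_pow_L2:
  assumes N: "p ^ t dvd N" and u: "u \<in> L 2" and g: "g \<in> carrier G"
  shows "(g \<otimes> u \<otimes> inv g) [^] N = u [^] N"
proof -
  have uc: "u \<in> carrier G" using u by (rule L.F_carrier)
  have z: "group_commutator G g u \<in> L 3" using u g by (intro commutator_L3)
  have "g \<otimes> u \<otimes> inv g = group_commutator G g u \<otimes> u"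
    using g uc by (rule conj_eq_group_commutator_mult)
  also have "\<dots> [^] N = group_commutator G g u [^] N \<otimes> u [^] N"
    using N z u g uc by (intro pow_mult_L2 dvd_imp_dvd_mult_pred) auto
  also have "\<dots> = u [^] N"
    using L3_pow[OF N z] uc by simp
  finally show ?thesis .
qed

lemma pow_L2_central:
  assumes N: "p ^ t dvd N" and u: "u \<in> L 2" and g: "g \<in> carrier G"
  shows "g \<otimes> u [^] N = u [^] N \<otimes> g"
proof -
  have uc: "u \<in> carrier G" using u by (rule L.F_carrier)
  have "g \<otimes> u [^] N \<otimes> inv g = u [^] N"
    using conj_pow_L2[OF assms] conj_nat_pow[OF g uc] by simp
  then show ?thesis using g uc by (metis inv_solve_right' m_closed nat_pow_closed inv_closed inv_inv)
qed

lemma commutator_pow_mult_left: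
  assumes N: "p ^ t dvd N" and c: "x \<in> carrier G" "x' \<in> carrier G" "y \<in> carrier G"
  shows "group_commutator G (x \<otimes> x') y [^] N = group_commutator G x y [^] N \<otimes> group_commutator G x' y [^] N"
proof -
  have "group_commutator G (x \<otimes> x') y [^] N =
    (x \<otimes> group_commutator G x' y \<otimes> inv x \<otimes> group_commutator G x y) [^] N"
    using c by (simp only: group_commutator_mult_left)
  also have "\<dots> = (x \<otimes> group_commutator G x' y \<otimes> inv x) [^] N \<otimes> group_commutator G x y [^] N"
    using N c by (intro pow_mult_L2 dvd_imp_dvd_mult_pred commutator_L2) auto
  also have "\<dots> = group_commutator G x y [^] N \<otimes> group_commutator G x' y [^] N"
    using c pow_L2_central[OF N, of "group_commutator G x y" "group_commutator G x' y [^] N"]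
    by (simp add: conj_pow_L2[OF N] commutator_L2)
  finally show ?thesis .
qed

lemma commutator_pow_swap:
  assumes "x \<in> carrier G" "y \<in> carrier G"
  shows "group_commutator G x y [^] (N :: nat) = inv (group_commutator G y x [^] N)"
  using assms by (simp add: inv_group_commutator flip: nat_pow_inv)

lemma commutator_pow_mult_right:
  assumes N: "p ^ t dvd N" and c: "x \<in> carrier G" "y \<in> carrier G" "y' \<in> carrier G"
  shows "group_commutator G x (y \<otimes> y') [^] N = group_commutator G x y [^] N \<otimes> group_commutator G x y' [^] N"
proof -
  have "group_commutator G x (y \<otimes> y') [^] N = inv (group_commutator G y x [^] N \<otimes> group_commutator G y' x [^] N)"
    using c by (simp add: commutator_pow_swap[of x] commutator_pow_mult_left[OF N])
  also have "\<dots> = group_commutator G x y' [^] N \<otimes> group_commutator G x y [^] N"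
    using c by (simp add: inv_mult_group commutator_pow_swap[of x])
  also have "\<dots> = group_commutator G x y [^] N \<otimes> group_commutator G x y' [^] N"
    using c pow_L2_central[OF N, of "group_commutator G x y" "group_commutator G x y' [^] N"]
    by (simp add: commutator_L2)
  finally show ?thesis .
qed

lemma commutator_pow_hom_right:
  assumes "p ^ t dvd N" "x \<in> carrier G"
  shows "group_hom G G (\<lambda>y. group_commutator G x y [^] N)"
  using assms
  by (auto simp: group_hom_def group_hom_axioms_def hom_def commutator_pow_mult_right)

lemma commutator_pow_hom_left:
  assumes "p ^ t dvd N" "y \<in> carrier G"
  shows "group_hom G G (\<lambda>x. group_commutator G x y [^] N)"
  using assms
  by (auto simp: group_hom_def group_hom_axioms_def hom_def commutator_pow_mult_left)

text \<open>
  The correction term is a conjugate of \<open>[inv y, inv x]\<close>; its exponent is a multiple of \<open>p ^ t\<close>, so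
  conjugation and the two inversions disappear.
\<close>

lemma Hall_formula_small_class:
  assumes n: "p ^ t dvd n * (n - 1)" and c: "x \<in> carrier G" "y \<in> carrier G"
  shows "(x \<otimes> y) [^] n = x [^] n \<otimes> y [^] n \<otimes> group_commutator G y x [^] (n choose 2)"
proof -
  have N: "p ^ t dvd n choose 2"
    using p_ge_3 by (intro prime_power_dvd_choose[OF p(1) _ _ n]) auto
  define e where "e = inv y \<otimes> group_commutator G (inv y) (inv x) \<otimes> y"
  have "(x \<otimes> y) [^] n = x [^] n \<otimes> y [^] n \<otimes> e [^] (n choose 2)"
    unfolding e_def by (rule L.Hall_formula) (use c pow_choose_eq_one[OF n] in auto)
  moreover have "e [^] (n choose 2) = group_commutator G y x [^] (n choose 2)"
  proof -
    have "e [^] (n choose 2) = group_commutator G (inv y) (inv x) [^] (n choose 2)"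
      unfolding e_def using conj_pow_L2[OF N commutator_L2, of "inv y" "inv x" "inv y"] c by simp
    also have "\<dots> = group_commutator G y x [^] (n choose 2)"
      using group_hom.hom_inv[OF commutator_pow_hom_left[OF N, of "inv x"] c(2)]
        group_hom.hom_inv[OF commutator_pow_hom_right[OF N, of y] c(1)] c
      by simp
    finally show ?thesis .
  qed
  ultimately show ?thesis by simp
qed

text \<open>
  Here \<open>x \<otimes> inv y \<otimes> inv x = inv y \<otimes> [y, x]\<close>, and taking \<open>N\<close>-th powers is multiplicative on the
  right-hand side. This identity ties powers of commutators to the exponent of \<open>G\<close> modulo its
  center.
\<close>

lemma commutator_of_pow:
  assumes N: "p ^ t dvd N" and c: "x \<in> carrier G" "y \<in> carrier G"
  shows "group_commutator G (y [^] N) x = group_commutator G y x [^] N"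
proof -
  have "x \<otimes> inv (y [^] N) \<otimes> inv x = (x \<otimes> inv y \<otimes> inv x) [^] N"
    using c by (simp add: conj_nat_pow nat_pow_inv)
  also have "x \<otimes> inv y \<otimes> inv x = inv y \<otimes> group_commutator G y x"
    using c by (simp add: group_commutator_def free_reduce)
  also have "\<dots> [^] N = inv (y [^] N) \<otimes> group_commutator G y x [^] N"
    using N c by (simp add: pow_mult_L2 commutator_L2 nat_pow_inv)
  finally have "y [^] N \<otimes> (x \<otimes> inv (y [^] N) \<otimes> inv x) = group_commutator G y x [^] N"
    using c by (simp add: mult_inv_cancel_left)
  then show ?thesis using c by (simp add: group_commutator_def m_assoc)
qed

end

section \<open>The holomorph\<close>

context group
begin

lemma right_regular_comp_auto_Bij:
  assumes "s \<in> carrier G" "\<phi> \<in> auto G"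
  shows "(\<lambda>x\<in>carrier G. \<phi> x \<otimes> inv s) \<in> Bij (carrier G)"
    and "right_regular G s \<in> Bij (carrier G)"
    and "compose (carrier G) (right_regular G s) \<phi> = (\<lambda>x\<in>carrier G. \<phi> x \<otimes> inv s)"
proof -
  have "bij_betw (\<lambda>x. x \<otimes> inv s) (carrier G) (carrier G)"
    by (rule bij_betw_byWitness[where f' = "\<lambda>x. x \<otimes> s"]) (use assms in \<open>auto simp: m_assoc\<close>)
  then show R: "right_regular G s \<in> Bij (carrier G)"
    by (simp add: Bij_def right_regular_def cong: bij_betw_cong)
  have \<phi>: "\<phi> \<in> Bij (carrier G)" "\<phi> \<in> carrier G \<rightarrow> carrier G"
    using assms(2) Bij_imp_funcset by (auto simp: auto_def)
  show c: "compose (carrier G) (right_regular G s) \<phi> = (\<lambda>x\<in>carrier G. \<phi> x \<otimes> inv s)"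
    using \<phi> by (auto simp: compose_def right_regular_def intro!: restrict_ext)
  show "(\<lambda>x\<in>carrier G. \<phi> x \<otimes> inv s) \<in> Bij (carrier G)"
    using compose_Bij[OF R \<phi>(1)] by (simp add: c)
qed

text \<open>
  Elements of the holomorph are handled as affine maps: an automorphism followed by a right
  translation.
\<close>

lemma Hol_eq: "Hol G = {\<lambda>x\<in>carrier G. \<phi> x \<otimes> inv s | s \<phi>. s \<in> carrier G \<and> \<phi> \<in> auto G}"
proof -
  have "right_regular G s \<otimes>\<^bsub>BijGroup (carrier G)\<^esub> \<phi> = (\<lambda>x\<in>carrier G. \<phi> x \<otimes> inv s)"
    if "s \<in> carrier G" "\<phi> \<in> auto G" for s \<phi>
    using right_regular_comp_auto_Bij[OF that] that by (simp add: BijGroup_def auto_def)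
  then show ?thesis
    by (auto simp: Hol_def set_mult_def)
qed

lemma HolI:
  "s \<in> carrier G \<Longrightarrow> \<phi> \<in> auto G \<Longrightarrow> (\<lambda>x\<in>carrier G. \<phi> x \<otimes> inv s) \<in> Hol G"
  by (auto simp: Hol_eq)

lemma auto_apply:
  assumes "\<phi> \<in> auto G"
  shows "x \<in> carrier G \<Longrightarrow> \<phi> x \<in> carrier G"
    and "x \<in> carrier G \<Longrightarrow> y \<in> carrier G \<Longrightarrow> \<phi> (x \<otimes> y) = \<phi> x \<otimes> \<phi> y"
    and "x \<in> carrier G \<Longrightarrow> \<phi> (inv x) = inv (\<phi> x)"
    and "x \<in> carrier G \<Longrightarrow> \<phi> (x [^] (n :: nat)) = \<phi> x [^] n"
    and "\<phi> \<in> Bij (carrier G)"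
proof -
  interpret \<phi>: group_hom G G \<phi>
    using assms by (simp add: auto_def group_hom_def group_hom_axioms_def group_axioms)
  show "x \<in> carrier G \<Longrightarrow> \<phi> x \<in> carrier G"
    and "x \<in> carrier G \<Longrightarrow> y \<in> carrier G \<Longrightarrow> \<phi> (x \<otimes> y) = \<phi> x \<otimes> \<phi> y"
    and "x \<in> carrier G \<Longrightarrow> \<phi> (inv x) = inv (\<phi> x)"
    and "x \<in> carrier G \<Longrightarrow> \<phi> (x [^] (n :: nat)) = \<phi> x [^] n"
    by (simp_all add: \<phi>.hom_nat_pow)
  show "\<phi> \<in> Bij (carrier G)" using assms by (simp add: auto_def)
qed

lemma subgroup_Hol: "subgroup (Hol G) (BijGroup (carrier G))"
proof -
  let ?B = "BijGroup (carrier G)"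
  interpret B: group ?B by (rule group_BijGroup)
  have Bij: "f \<in> Bij (carrier G)" if "f \<in> Hol G" for f
    using that right_regular_comp_auto_Bij(1) by (auto simp: Hol_eq)
  have mult: "f \<otimes>\<^bsub>?B\<^esub> g \<in> Hol G" if "f \<in> Hol G" "g \<in> Hol G" for f g
  proof -
    obtain s \<phi> where f: "f = (\<lambda>x\<in>carrier G. \<phi> x \<otimes> inv s)" "s \<in> carrier G" "\<phi> \<in> auto G"
      using \<open>f \<in> Hol G\<close> by (auto simp: Hol_eq)
    obtain u \<psi> where g: "g = (\<lambda>x\<in>carrier G. \<psi> x \<otimes> inv u)" "u \<in> carrier G" "\<psi> \<in> auto G"
      using \<open>g \<in> Hol G\<close> by (auto simp: Hol_eq)
    have "compose (carrier G) \<phi> \<psi> \<in> auto G"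
      using subgroup.m_closed[OF subgroup_auto f(3) g(3)] auto_apply(5)[OF f(3)] auto_apply(5)[OF g(3)]
      by (simp add: BijGroup_def)
    then have "(\<lambda>x\<in>carrier G. compose (carrier G) \<phi> \<psi> x \<otimes> inv (s \<otimes> \<phi> u)) \<in> Hol G"
      using f g by (intro HolI) (auto simp: auto_apply)
    moreover have "f \<otimes>\<^bsub>?B\<^esub> g = (\<lambda>x\<in>carrier G. compose (carrier G) \<phi> \<psi> x \<otimes> inv (s \<otimes> \<phi> u))"
      using Bij[OF that(1)] Bij[OF that(2)] f g
      by (auto simp: BijGroup_def compose_def auto_apply inv_mult_group m_assoc)
    ultimately show ?thesis by simp
  qed
  show ?thesis
  proof (rule B.subgroupI)
    show "Hol G \<subseteq> carrier ?B" using Bij by (auto simp: BijGroup_def)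
    show "Hol G \<noteq> {}" using HolI[OF one_closed id_in_auto] by blast
  next
    fix f assume "f \<in> Hol G"
    then obtain s \<phi> where f: "f = (\<lambda>x\<in>carrier G. \<phi> x \<otimes> inv s)" "s \<in> carrier G" "\<phi> \<in> auto G"
      by (auto simp: Hol_eq)
    define \<psi> where "\<psi> = inv\<^bsub>?B\<^esub> \<phi>"
    have \<psi>: "\<psi> \<in> auto G" unfolding \<psi>_def by (rule subgroup.m_inv_closed[OF subgroup_auto f(3)])
    have \<psi>\<phi>: "\<psi> (\<phi> x) = x" if "x \<in> carrier G" for x
    proof -
      have "\<psi> \<otimes>\<^bsub>?B\<^esub> \<phi> = \<one>\<^bsub>?B\<^esub>"
        unfolding \<psi>_def by (rule B.l_inv) (use f(3) auto_apply(5) in \<open>auto simp: BijGroup_def\<close>)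
      then have "compose (carrier G) \<psi> \<phi> x = x"
        using that auto_apply(5)[OF f(3)] auto_apply(5)[OF \<psi>] by (simp add: BijGroup_def)
      then show ?thesis using that by (simp add: compose_def)
    qed
    have g: "(\<lambda>x\<in>carrier G. \<psi> x \<otimes> inv (inv (\<psi> s))) \<in> Hol G" (is "?g \<in> _")
      using f \<psi> by (intro HolI) (auto simp: auto_apply)
    have "?g \<otimes>\<^bsub>?B\<^esub> f = \<one>\<^bsub>?B\<^esub>"
      using Bij[OF g] Bij[OF \<open>f \<in> Hol G\<close>] f \<psi>
      by (auto simp: BijGroup_def compose_def auto_apply \<psi>\<phi> m_assoc)
    then have "inv\<^bsub>?B\<^esub> f = ?g"
      using Bij[OF g] Bij[OF \<open>f \<in> Hol G\<close>] by (intro B.inv_equality) (auto simp: BijGroup_def)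
    then show "inv\<^bsub>?B\<^esub> f \<in> Hol G" using g by simp
  qed (rule mult)
qed

lemma normalizerI_finite:
  assumes "finite H" "H \<subseteq> carrier G" "g \<in> carrier G"
    and closed: "\<And>h. h \<in> H \<Longrightarrow> g \<otimes> h \<otimes> inv g \<in> H"
  shows "g \<in> normalizer G H"
proof -
  have "inj_on (\<lambda>h. g \<otimes> h \<otimes> inv g) H"
    using assms(2,3) by (intro inj_onI) (simp add: subset_iff)
  then have "(\<lambda>h. g \<otimes> h \<otimes> inv g) ` H = H"
    using closed by (intro endo_inj_surj[OF assms(1)]) auto
  moreover have "g <# H #> inv g = (\<lambda>h. g \<otimes> h \<otimes> inv g) ` H"
    by (auto simp: l_coset_def r_coset_def)
  ultimately show ?thesis
    using assms(2,3) by (simp add: normalizer_def stabilizer_def)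
qed

lemma finite_Hol:
  assumes "finite (carrier G)"
  shows "finite (Hol G)"
proof -
  have "Bij (carrier G) \<subseteq> (carrier G \<rightarrow>\<^sub>E carrier G)"
    using Bij_imp_funcset Bij_imp_extensional by (auto simp: PiE_def)
  then have "finite (Bij (carrier G))"
    using assms finite_PiE finite_subset by metis
  moreover have "Hol G \<subseteq> Bij (carrier G)"
    using subgroup.subset[OF subgroup_Hol] by (simp add: BijGroup_def)
  ultimately show ?thesis by (rule rev_finite_subset)
qed

end

section \<open>Power maps and the holomorph\<close>

text \<open>
  The last two assumptions say that \<open>p ^ r\<close> is the exponent of \<open>G\<close> modulo its center.
\<close>

locale small_class_p_group = small_class_group +
  fixes k r :: nat
  assumes order_G: "order G = p ^ k"
    and pow_central: "x \<in> carrier G \<Longrightarrow> y \<in> carrier G \<Longrightarrow> x [^] (p ^ r) \<otimes> y = y \<otimes> x [^] (p ^ r)"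
    and pow_central_dvd:
      "(\<And>x y. x \<in> carrier G \<Longrightarrow> y \<in> carrier G \<Longrightarrow> x [^] m \<otimes> y = y \<otimes> x [^] m) \<Longrightarrow> p ^ r dvd m"
begin

lemma finite_G: "finite (carrier G)"
proof -
  have "0 < order G" using order_G p prime_gt_0_nat by simp
  then show ?thesis by (simp add: order_gt_0_iff_finite)
qed

lemma int_pow_cong:
  assumes "x \<in> carrier G" "[m = n] (mod int p ^ k)"
  shows "x [^] (m :: int) = x [^] n"
proof -
  obtain d where d: "m = n + int p ^ k * d"
    using assms(2) by (metis cong_iff_lin cong_sym)
  have "x [^] (int p ^ k) = \<one>"
    using pow_order_eq_1[OF assms(1)] order_G by (metis int_pow_int of_nat_power)
  then show ?thesis
    using assms(1) by (simp add: d int_pow_mult flip: int_pow_pow)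
qed

lemma power_map_cong: "[m = n] (mod int p ^ k) \<Longrightarrow> power_map G m = power_map G n"
  unfolding power_map_def using int_pow_cong by (metis restrict_ext)

lemma compose_power_map:
  "compose (carrier G) (power_map G m) (power_map G n) = power_map G (m * n)"
  by (auto simp: compose_def power_map_def int_pow_pow mult.commute)

text \<open>
  The modulus is a multiple of \<open>p ^ k\<close>, \<open>p ^ r\<close>, \<open>p ^ t\<close> and \<open>p\<close>, so that one inverse serves for
  exponents of elements, for residue classes and for admissibility.
\<close>

lemma ex_inverse:
  assumes "admissible p t n"
  obtains n' where "admissible p t n'" "[n * n' = 1] (mod int p ^ (Suc (k + r + t)))"
proof -
  let ?M = "int p ^ (Suc (k + r + t))"
  have "coprime n ?M"
    using assms p(1) prime_imp_coprime[of "int p" n]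
    by (simp only: admissible_def coprime_power_right_iff coprime_commute[of n]) simp
  then obtain n' where n': "[n * n' = 1] (mod ?M)"
    using cong_solve_coprime_int by blast
  have "[n * n' = 1] (mod int p)"
    using n' by (rule cong_dvd_modulus) simp
  moreover have "\<not> int p dvd 1"
    using prime_gt_1_nat[OF p(1)] by simp
  ultimately have "\<not> int p dvd n'"
    by (metis cong_dvd_iff dvd_mult)
  moreover have "[n * n' = 1] (mod int p ^ t)"
    using n' by (rule cong_dvd_modulus) (simp add: le_imp_power_dvd flip: power_Suc)
  then have "[n' = 1] (mod int p ^ t)"
    using assms by (metis admissible_def cong_scalar_right cong_sym cong_trans mult_1)
  ultimately show ?thesis
    using that n' by (simp add: admissible_def)
qed

lemma admissible_mult: "admissible p t m \<Longrightarrow> admissible p t n \<Longrightarrow> admissible p t (m * n)"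
  using p(1) cong_mult[of m 1 "int p ^ t" n 1] by (auto simp: admissible_def prime_dvd_mult_iff)

lemma admissible_one: "admissible p t 1"
  using prime_gt_1_nat[OF p(1)] by (simp add: admissible_def)

lemma cong_modulus:
  assumes "[a = b] (mod int p ^ (Suc (k + r + t)))"
  shows "[a = b] (mod int p ^ k)" "[a = b] (mod int p ^ r)" "[a = b] (mod int p ^ t)" "[a = b] (mod int p)"
  by (rule cong_dvd_modulus[OF assms], simp add: le_imp_power_dvd flip: power_Suc)+

lemma power_map_Bij:
  assumes "admissible p t n"
  shows "power_map G n \<in> Bij (carrier G)"
proof -
  obtain n' where n': "[n * n' = 1] (mod int p ^ (Suc (k + r + t)))"
    using ex_inverse[OF assms] by blast
  have eq: "x [^] (n * n') = x" if "x \<in> carrier G" for x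
    using int_pow_cong[OF that cong_modulus(1)[OF n']] that by simp
  have "bij_betw (\<lambda>x. x [^] n) (carrier G) (carrier G)"
    by (rule bij_betw_byWitness[where f' = "\<lambda>x. x [^] n'"])
      (auto simp: int_pow_pow eq mult.commute[of n' n])
  then show ?thesis
    by (simp add: Bij_def power_map_def cong: bij_betw_cong)
qed

text \<open>
  Hall's formula concerns natural exponents; reducing \<open>n\<close> modulo a large power of \<open>p\<close> produces one
  without changing the power map.
\<close>

lemma ex_nat_representative:
  assumes "admissible p t n"
  obtains m where "power_map G n = power_map G (int m)" "[n = int m] (mod int p ^ r)"
    "p ^ t dvd m - 1" "0 < m" "\<not> p dvd m"
proof -
  let ?M = "int p ^ (Suc (k + r + t))"
  define m where "m = nat (n mod ?M)"
  have "0 < ?M" using prime_gt_0_nat[OF p(1)] by simp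
  then have m: "int m = n mod ?M" by (simp add: m_def)
  then have cong: "[int m = n] (mod ?M)" by (simp add: cong_def)
  have pm: "\<not> p dvd m"
    using assms cong_dvd_iff[OF cong_modulus(4)[OF cong]] by (simp add: admissible_def)
  then have m0: "0 < m" by (cases m) auto
  have "[int m = 1] (mod int p ^ t)"
    using cong_modulus(3)[OF cong] assms by (metis admissible_def cong_trans)
  then have "int (p ^ t) dvd int (m - 1)"
    using m0 by (simp add: cong_iff_dvd_diff of_nat_diff)
  then have "p ^ t dvd m - 1" by (simp only: int_dvd_int_iff)
  moreover have "power_map G n = power_map G (int m)"
    using cong_modulus(1)[OF cong] by (metis power_map_cong)
  moreover have "[n = int m] (mod int p ^ r)"
    using cong_modulus(2)[OF cong] by (rule cong_sym)
  ultimately show ?thesis using that m0 pm by blast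
qed

lemma power_map_nat: "power_map G (int m) = (\<lambda>x\<in>carrier G. x [^] m)"
  by (simp add: power_map_def int_pow_int)

text \<open>
  The map is multiplicative because \<open>[s, w]\<close> to the power \<open>N\<close> is central and multiplicative in \<open>w\<close>.
  An element of the kernel is the inverse of a central element, so its commutator with \<open>s\<close> is trivial
  and the map fixes it. Finiteness of \<open>G\<close> turns injectivity into bijectivity.
\<close>

lemma commutator_twist_auto:
  assumes N: "p ^ t dvd N" and s: "s \<in> carrier G"
  shows "(\<lambda>w\<in>carrier G. w \<otimes> group_commutator G s w [^] N) \<in> auto G" (is "?\<alpha> \<in> _")
proof -
  interpret \<beta>: group_hom G G "\<lambda>w. group_commutator G s w [^] N"
    by (rule commutator_pow_hom_right[OF N s])
  have cen: "x \<otimes> group_commutator G s w [^] N = group_commutator G s w [^] N \<otimes> x"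
    if "x \<in> carrier G" "w \<in> carrier G" for x w
    using that s N by (intro pow_L2_central commutator_L2) auto
  have hom: "?\<alpha> \<in> hom G G"
  proof (rule homI)
    fix x y assume xy: "x \<in> carrier G" "y \<in> carrier G"
    have "x \<otimes> y \<otimes> (group_commutator G s x [^] N \<otimes> group_commutator G s y [^] N)
      = x \<otimes> (y \<otimes> group_commutator G s x [^] N) \<otimes> group_commutator G s y [^] N"
      using xy s by (simp add: m_assoc)
    also have "\<dots> = (x \<otimes> group_commutator G s x [^] N) \<otimes> (y \<otimes> group_commutator G s y [^] N)"
      unfolding cen[OF xy(2,1)] using xy s by (simp add: m_assoc)
    finally show "?\<alpha> (x \<otimes> y) = ?\<alpha> x \<otimes> ?\<alpha> y"
      using xy s \<beta>.hom_mult[OF xy] by simp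
  qed (use s in simp)
  interpret \<alpha>: group_hom G G ?\<alpha>
    using hom by (simp add: group_hom_def group_hom_axioms_def group_axioms)
  have "w = \<one>" if w: "w \<in> carrier G" "?\<alpha> w = \<one>" for w
  proof -
    define b where "b = group_commutator G s w [^] N"
    have b: "b \<in> carrier G" "w \<otimes> b = \<one>" using w s by (simp_all add: b_def)
    have "w = inv b" using b w(1) by (simp add: inv_equality)
    moreover have "s \<otimes> b = b \<otimes> s" unfolding b_def by (rule cen[OF s w(1)])
    ultimately have "s \<otimes> w = w \<otimes> s"
      using s b(1) by (metis inv_mult_group inv_inv inv_closed inv_solve_left inv_solve_right' m_assoc m_closed)
    then have "group_commutator G s w = \<one>"
      using s w(1) by (simp add: group_commutator_def m_assoc mult_inv_cancel_left)
    then show "w = \<one>" using w by simp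
  qed
  then have "inj_on ?\<alpha> (carrier G)"
    using \<alpha>.inj_on_one_iff by blast
  moreover have "?\<alpha> ` carrier G \<subseteq> carrier G" using s by auto
  ultimately have "bij_betw ?\<alpha> (carrier G) (carrier G)"
    using endo_inj_surj[OF finite_G] by (simp add: bij_betw_def)
  then show ?thesis
    using hom by (simp add: auto_def Bij_def)
qed

text \<open>
  Let \<open>m\<close> be a positive representative of \<open>n\<close>. Hall's formula writes the \<open>m\<close>-th power of \<open>x \<otimes> inv s\<close> as the image of the \<open>m\<close>-th power of \<open>x\<close> under
  a twist automorphism, followed by right translation by the inverse of the \<open>m\<close>-th power of \<open>s\<close>. Power
  maps commute with automorphisms, so conjugation by a power map carries the finite set \<open>Hol G\<close> into
  itself.
\<close>

lemma power_map_normalizes_Hol: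
  assumes "admissible p t n"
  shows "power_map G n \<in> NHol G"
proof -
  let ?B = "BijGroup (carrier G)"
  interpret B: group ?B by (rule group_BijGroup)
  obtain m where m: "power_map G n = power_map G (int m)" "p ^ t dvd m - 1" "0 < m" "\<not> p dvd m"
    using ex_nat_representative[OF assms] by metis
  have "coprime m (p ^ k)"
    using m(4) p(1) prime_imp_coprime[of p m]
    by (simp only: coprime_power_right_iff coprime_commute[of m]) simp
  then obtain m' where m': "[m * m' = 1] (mod p ^ k)"
    using cong_solve_coprime_nat[OF \<open>coprime m (p ^ k)\<close>] by auto
  \<comment> \<open>The factor \<open>m'\<close> expresses the correction term through the \<open>m\<close>-th power of \<open>x\<close> in place of \<open>x\<close>.\<close>
  define N where "N = (m choose 2) * m'"
  have dvd: "p ^ t dvd m * (m - 1)" using m(2) by simp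
  have "p ^ t dvd m choose 2"
    using p_ge_3 by (intro prime_power_dvd_choose[OF p(1) _ _ dvd]) auto
  then have N: "p ^ t dvd N" by (simp add: N_def)
  have pow_id: "x [^] (m * m') = x" if "x \<in> carrier G" for x
  proof -
    have "[int (m * m') = 1] (mod int p ^ k)"
      using m' by (metis cong_int_iff of_nat_1 of_nat_power)
    then have "x [^] int (m * m') = x"
      using int_pow_cong[OF that] that by simp
    then show ?thesis by (simp only: int_pow_int)
  qed
  have \<pi>: "power_map G n \<in> carrier ?B"
    using power_map_Bij[OF assms] by (simp add: BijGroup_def)
  have "power_map G n \<otimes>\<^bsub>?B\<^esub> h \<otimes>\<^bsub>?B\<^esub> inv\<^bsub>?B\<^esub> power_map G n \<in> Hol G" if h: "h \<in> Hol G" for h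
  proof -
    obtain s \<phi> where h': "h = (\<lambda>x\<in>carrier G. \<phi> x \<otimes> inv s)" "s \<in> carrier G" "\<phi> \<in> auto G"
      using h by (auto simp: Hol_eq)
    define \<alpha> where "\<alpha> = (\<lambda>w\<in>carrier G. w \<otimes> group_commutator G (inv s) w [^] N)"
    have \<alpha>: "\<alpha> \<in> auto G" unfolding \<alpha>_def using N h' by (intro commutator_twist_auto) auto
    have \<alpha>\<phi>: "compose (carrier G) \<alpha> \<phi> \<in> auto G"
      using subgroup.m_closed[OF subgroup_auto \<alpha> h'(3)] auto_apply(5)[OF h'(3)] auto_apply(5)[OF \<alpha>]
      by (simp add: BijGroup_def)
    define h2 where "h2 = (\<lambda>x\<in>carrier G. compose (carrier G) \<alpha> \<phi> x \<otimes> inv (s [^] m))"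
    have h2: "h2 \<in> Hol G" unfolding h2_def using h' \<alpha>\<phi> by (intro HolI) auto
    have carr: "h \<in> carrier ?B" "h2 \<in> carrier ?B"
      using h h2 subgroup.subset[OF subgroup_Hol] by auto
    have key: "(x \<otimes> inv s) [^] m = \<alpha> (x [^] m) \<otimes> inv (s [^] m)" if x: "x \<in> carrier G" for x
    proof -
      define u where "u = inv s"
      have u: "u \<in> carrier G" using h' by (simp add: u_def)
      have "group_commutator G u (x [^] m) [^] N = (group_commutator G u x [^] N) [^] m"
        using group_hom.hom_nat_pow[OF commutator_pow_hom_right[OF N u] x, of m] by simp
      also have "\<dots> = (group_commutator G u x [^] (m choose 2)) [^] (m * m')"
        using u x by (simp add: nat_pow_pow N_def ac_simps)
      also have "\<dots> = group_commutator G u x [^] (m choose 2)"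
        using u x by (intro pow_id) simp
      finally have "\<alpha> (x [^] m) = x [^] m \<otimes> group_commutator G u x [^] (m choose 2)"
        using x by (simp add: \<alpha>_def u_def)
      moreover have "(x \<otimes> u) [^] m = x [^] m \<otimes> (u [^] m \<otimes> group_commutator G u x [^] (m choose 2))"
        using Hall_formula_small_class[OF dvd x u] x u by (simp add: m_assoc)
      moreover have "u [^] m \<otimes> group_commutator G u x [^] (m choose 2) = group_commutator G u x [^] (m choose 2) \<otimes> u [^] m"
        using \<open>p ^ t dvd m choose 2\<close> u x by (intro pow_L2_central commutator_L2) auto
      moreover have "u [^] m = inv (s [^] m)" using h' by (simp add: u_def nat_pow_inv)
      ultimately show ?thesis using x u h' by (simp add: m_assoc u_def)
    qed
    have "power_map G n \<otimes>\<^bsub>?B\<^esub> h = h2 \<otimes>\<^bsub>?B\<^esub> power_map G n"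
      using \<pi> carr h' unfolding h2_def m(1)
      by (auto simp: BijGroup_def compose_def power_map_nat auto_apply key)
    then have "power_map G n \<otimes>\<^bsub>?B\<^esub> h \<otimes>\<^bsub>?B\<^esub> inv\<^bsub>?B\<^esub> power_map G n = h2"
      using \<pi> carr by (simp add: B.m_assoc)
    then show ?thesis using h2 by simp
  qed
  then show ?thesis
    unfolding NHol_def using \<pi> subgroup.subset[OF subgroup_Hol]
    by (intro B.normalizerI_finite finite_Hol finite_G) auto
qed

text \<open>
  A power map fixes \<open>\<one>\<close>, so it lies in the holomorph iff it is an automorphism. By Hall's formula,
  with \<open>m\<close> a positive representative of \<open>n\<close>, this means that \<open>[y, x]\<close> to the power \<open>m choose 2\<close> is always trivial; by \<open>commutator_of_pow\<close> this
  power is the commutator of \<open>y\<close> to the power \<open>m choose 2\<close> with \<open>x\<close>. Hence the condition is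
  that \<open>p ^ r\<close>, the exponent modulo the center, divides \<open>m choose 2\<close>, equivalently \<open>m - 1\<close>,
  because \<open>p\<close> is odd and does not divide \<open>m\<close>.
\<close>

lemma power_map_in_Hol_iff:
  assumes "admissible p t n"
  shows "power_map G n \<in> Hol G \<longleftrightarrow> [n = 1] (mod int p ^ r)"
proof -
  obtain m where m: "power_map G n = power_map G (int m)" "[n = int m] (mod int p ^ r)"
      "p ^ t dvd m - 1" "0 < m" "\<not> p dvd m"
    using ex_nat_representative[OF assms] by metis
  have dvd: "p ^ t dvd m * (m - 1)" using m(3) by simp
  have C: "p ^ t dvd m choose 2"
    using p_ge_3 by (intro prime_power_dvd_choose[OF p(1) _ _ dvd]) auto
  have comm: "group_commutator G y x [^] (m choose 2) = group_commutator G (y [^] (m choose 2)) x"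
    if "x \<in> carrier G" "y \<in> carrier G" for x y
    using commutator_of_pow[OF C that] by simp
  have cong: "[n = 1] (mod int p ^ r) \<longleftrightarrow> p ^ r dvd m - 1"
  proof -
    have "[n = 1] (mod int p ^ r) \<longleftrightarrow> [int m = 1] (mod int p ^ r)"
      using m(2) cong_sym cong_trans by metis
    also have "\<dots> \<longleftrightarrow> int (p ^ r) dvd int (m - 1)"
      using m(4) by (simp add: cong_iff_dvd_diff of_nat_diff)
    finally show ?thesis by (simp only: int_dvd_int_iff)
  qed
  have "power_map G n \<in> Hol G \<longleftrightarrow> p ^ r dvd m - 1"
  proof
    assume "power_map G n \<in> Hol G"
    then obtain s \<phi> where h: "power_map G n = (\<lambda>x\<in>carrier G. \<phi> x \<otimes> inv s)" "s \<in> carrier G" "\<phi> \<in> auto G"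
      by (auto simp: Hol_eq)
    have val: "x [^] m = \<phi> x \<otimes> inv s" if "x \<in> carrier G" for x
      using fun_cong[OF h(1), of x] that by (simp add: m(1) power_map_nat)
    interpret \<phi>: group_hom G G \<phi>
      using h(3) by (simp add: auto_def group_hom_def group_hom_axioms_def group_axioms)
    have "inv s = \<one>" using val[OF one_closed] h(2) by simp
    then have val: "x [^] m = \<phi> x" if "x \<in> carrier G" for x
      using val[OF that] that by simp
    have "p ^ r dvd m choose 2"
    proof (rule pow_central_dvd)
      fix y x assume c: "y \<in> carrier G" "x \<in> carrier G"
      have "x [^] m \<otimes> y [^] m \<otimes> group_commutator G y x [^] (m choose 2) = x [^] m \<otimes> y [^] m"
        using Hall_formula_small_class[OF dvd c(2,1)] val c by simp
      then have "group_commutator G (y [^] (m choose 2)) x = \<one>"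
        using c comm by (simp add: r_cancel_one')
      then have "y [^] (m choose 2) \<otimes> x \<otimes> inv (y [^] (m choose 2)) = x"
        using c by (simp add: group_commutator_def) (metis inv_closed inv_equality inv_inv m_closed nat_pow_closed)
      then show "y [^] (m choose 2) \<otimes> x = x \<otimes> y [^] (m choose 2)"
        using c by (metis inv_closed inv_solve_right' m_closed nat_pow_closed)
    qed
    then have "p ^ r dvd 2 * (m choose 2)" by simp
    also have "2 * (m choose 2) = m * (m - 1)"
      using times_binomial_minus1_eq[of 2 m] by simp
    finally show "p ^ r dvd m - 1"
      using m(5) p(1) by (metis coprime_commute coprime_dvd_mult_right_iff coprime_power_left_iff prime_imp_coprime)
  next
    assume r: "p ^ r dvd m - 1"
    have "p ^ r dvd m choose 2"
      using p_ge_3 r by (intro prime_power_dvd_choose[OF p(1)]) auto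
    then obtain d where d: "m choose 2 = p ^ r * d" by (auto elim: dvdE)
    have trivial: "group_commutator G y x [^] (m choose 2) = \<one>" if c: "x \<in> carrier G" "y \<in> carrier G" for x y
    proof -
      have "(y [^] d) [^] (p ^ r) \<otimes> x = x \<otimes> (y [^] d) [^] (p ^ r)"
        using c by (intro pow_central) auto
      then have "y [^] (m choose 2) \<otimes> x = x \<otimes> y [^] (m choose 2)"
        using c by (simp add: d nat_pow_pow mult.commute)
      then show ?thesis
        unfolding comm[OF c] using c by (simp add: group_commutator_def m_assoc mult_inv_cancel_left)
    qed
    have "power_map G n \<in> hom G G"
      using Hall_formula_small_class[OF dvd] trivial by (auto simp: m(1) power_map_nat hom_def)
    then have "power_map G n \<in> auto G"
      using power_map_Bij[OF assms] by (simp add: auto_def)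
    then have "(\<lambda>x\<in>carrier G. power_map G n x \<otimes> inv \<one>) \<in> Hol G"
      by (intro HolI) auto
    moreover have "(\<lambda>x\<in>carrier G. power_map G n x \<otimes> inv \<one>) = power_map G n"
      by (auto simp: m(1) power_map_nat)
    ultimately show "power_map G n \<in> Hol G" by simp
  qed
  then show ?thesis using cong by simp
qed

end

section \<open>Residue classes and the homomorphism to the quotient\<close>

lemma residue_class_eq_iff: "residue_class q m = residue_class q n \<longleftrightarrow> [m = n] (mod q)"
  by (auto simp: residue_class_eq cong_def)

lemma residue_class_ideal: "ideal (Idl\<^bsub>\<Z>\<^esub> {q}) \<Z>"
  by (rule int.genideal_ideal) simp

lemma residue_class_mult:
  "residue_class q m \<otimes>\<^bsub>ZFact q\<^esub> residue_class q n = residue_class q (m * n)"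
  using ideal.rcoset_mult_add[OF residue_class_ideal, of m n q]
  by (simp add: residue_class_def ZFact_def FactRing_def)

lemma residue_class_one: "\<one>\<^bsub>ZFact q\<^esub> = residue_class q 1"
  by (simp add: residue_class_def ZFact_def FactRing_def)

lemma residue_class_closed: "residue_class q n \<in> carrier (ZFact q)"
  using int.a_rcosetsI[of "Idl\<^bsub>\<Z>\<^esub> {q}" n]
  by (simp add: residue_class_def ZFact_def FactRing_def)

context small_class_p_group
begin

lemma subgroup_T0: "subgroup (T0 p r t) (units_of (ZFact (int p ^ r)))"
proof -
  let ?q = "int p ^ r"
  interpret R: cring "ZFact ?q" by (rule ZFact_is_cring)
  interpret U: group "units_of (ZFact ?q)" by (rule R.units_group)
  have inverse: "\<exists>n'. admissible p t n' \<and> residue_class ?q n' \<otimes>\<^bsub>ZFact ?q\<^esub> residue_class ?q n = \<one>\<^bsub>ZFact ?q\<^esub>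
     \<and> residue_class ?q n \<otimes>\<^bsub>ZFact ?q\<^esub> residue_class ?q n' = \<one>\<^bsub>ZFact ?q\<^esub>"
    if n: "admissible p t n" for n
  proof -
    obtain n' where n': "admissible p t n'" "[n * n' = 1] (mod int p ^ (Suc (k + r + t)))"
      using ex_inverse[OF n] by blast
    then show ?thesis
      using cong_modulus(2)[OF n'(2)]
      by (intro exI[of _ n']) (simp add: residue_class_mult residue_class_one residue_class_eq_iff mult.commute)
  qed
  have unit: "residue_class ?q n \<in> Units (ZFact ?q)" if "admissible p t n" for n
    using inverse[OF that] residue_class_closed by (auto simp: Units_def)
  show ?thesis
  proof (rule U.subgroupI)
    show "T0 p r t \<subseteq> carrier (units_of (ZFact ?q))"
      using unit by (auto simp: T0_def units_of_carrier)
    show "T0 p r t \<noteq> {}" using admissible_one by (auto simp: T0_def)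
  next
    fix a assume "a \<in> T0 p r t"
    then obtain n where n: "admissible p t n" "a = residue_class ?q n" by (auto simp: T0_def)
    then obtain n' where n': "admissible p t n'"
      "residue_class ?q n' \<otimes>\<^bsub>ZFact ?q\<^esub> residue_class ?q n = \<one>\<^bsub>ZFact ?q\<^esub>"
      using inverse by blast
    then have "inv\<^bsub>units_of (ZFact ?q)\<^esub> a = residue_class ?q n'"
      using n unit by (intro U.inv_equality) (simp_all add: units_of_carrier units_of_mult units_of_one)
    then show "inv\<^bsub>units_of (ZFact ?q)\<^esub> a \<in> T0 p r t" using n' by (auto simp: T0_def)
  next
    fix a b assume "a \<in> T0 p r t" "b \<in> T0 p r t"
    then show "a \<otimes>\<^bsub>units_of (ZFact ?q)\<^esub> b \<in> T0 p r t"
      using admissible_mult by (auto simp: T0_def units_of_mult residue_class_mult)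
  qed
qed

lemma power_map_mult:
  assumes "admissible p t m" "admissible p t n"
  shows "power_map G m \<otimes>\<^bsub>BijGroup (carrier G)\<^esub> power_map G n = power_map G (m * n)"
  using assms power_map_Bij by (simp add: BijGroup_def compose_power_map)

text \<open>
  Well-definedness and injectivity in one statement: with an inverse \<open>n'\<close> of \<open>n\<close>, the two cosets
  agree iff the power map of \<open>d = n' * m\<close> lies in the holomorph, that is, iff \<open>d\<close> is \<open>1\<close> modulo
  \<open>p ^ r\<close>.
\<close>

lemma power_map_coset_eq_iff:
  assumes "admissible p t m" "admissible p t n"
  shows "power_map G m <#\<^bsub>BijGroup (carrier G)\<^esub> Hol G = power_map G n <#\<^bsub>BijGroup (carrier G)\<^esub> Hol G
    \<longleftrightarrow> residue_class (int p ^ r) m = residue_class (int p ^ r) n"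
proof -
  let ?B = "BijGroup (carrier G)"
  interpret B: group ?B by (rule group_BijGroup)
  interpret H: subgroup "Hol G" ?B by (rule subgroup_Hol)
  have carr: "power_map G i \<in> carrier ?B" if "admissible p t i" for i
    using power_map_Bij[OF that] by (simp add: BijGroup_def)
  obtain n' where n': "admissible p t n'" "[n * n' = 1] (mod int p ^ (Suc (k + r + t)))"
    using ex_inverse[OF assms(2)] by blast
  define d where "d = n' * m"
  have d: "admissible p t d" unfolding d_def by (intro admissible_mult n' assms)
  have "[n * d = m] (mod int p ^ (Suc (k + r + t)))"
    using cong_scalar_right[OF n'(2), of m] by (simp add: d_def mult.assoc)
  note nd = cong_modulus[OF this]
  have m: "power_map G m = power_map G n \<otimes>\<^bsub>?B\<^esub> power_map G d"
    using power_map_cong[OF nd(1)] power_map_mult[OF assms(2) d] by simp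
  have "power_map G m <#\<^bsub>?B\<^esub> Hol G = power_map G n <#\<^bsub>?B\<^esub> Hol G \<longleftrightarrow> power_map G d \<in> Hol G"
  proof
    assume "power_map G m <#\<^bsub>?B\<^esub> Hol G = power_map G n <#\<^bsub>?B\<^esub> Hol G"
    moreover have "power_map G m \<otimes>\<^bsub>?B\<^esub> \<one>\<^bsub>?B\<^esub> \<in> power_map G m <#\<^bsub>?B\<^esub> Hol G"
      unfolding l_coset_def using H.one_closed by blast
    ultimately obtain h where h: "h \<in> Hol G" "power_map G m = power_map G n \<otimes>\<^bsub>?B\<^esub> h"
      using carr[OF assms(1)] by (auto simp: l_coset_def)
    then have "power_map G d = h"
      using m carr assms d H.mem_carrier[OF h(1)] by (metis B.l_cancel)
    then show "power_map G d \<in> Hol G" using h by simp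
  next
    assume "power_map G d \<in> Hol G"
    then have "power_map G d <#\<^bsub>?B\<^esub> Hol G = Hol G"
      using carr[OF d] by (intro B.coset_join3 subgroup_Hol)
    then show "power_map G m <#\<^bsub>?B\<^esub> Hol G = power_map G n <#\<^bsub>?B\<^esub> Hol G"
      unfolding m using B.lcos_m_assoc[OF H.subset carr[OF assms(2)] carr[OF d]] by simp
  qed
  also have "\<dots> \<longleftrightarrow> [d = 1] (mod int p ^ r)"
    by (rule power_map_in_Hol_iff[OF d])
  also have "\<dots> \<longleftrightarrow> [m = n] (mod int p ^ r)"
  proof
    assume "[d = 1] (mod int p ^ r)"
    then show "[m = n] (mod int p ^ r)"
      using nd(2) cong_scalar_left[of d 1 _ n] by (metis cong_sym cong_trans mult.right_neutral)
  next
    assume "[m = n] (mod int p ^ r)"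
    then have "[d = n' * n] (mod int p ^ r)"
      unfolding d_def by (rule cong_scalar_left)
    then show "[d = 1] (mod int p ^ r)"
      using cong_modulus(2)[OF n'(2)] by (metis cong_trans mult.commute)
  qed
  finally show ?thesis by (simp add: residue_class_eq_iff)
qed

lemma power_map_quotient_hom:
  "\<exists>\<kappa>. (\<forall>n. admissible p t n \<longrightarrow>
        \<kappa> (residue_class (int p ^ r) n) = power_map G n <#\<^bsub>BijGroup (carrier G)\<^esub> Hol G)
      \<and> group_hom ((units_of (ZFact (int p ^ r)))\<lparr>carrier := T0 p r t\<rparr>) (NHol_mod_Hol G) \<kappa>
      \<and> inj_on \<kappa> (T0 p r t)"
proof -
  let ?B = "BijGroup (carrier G)"
  let ?q = "int p ^ r"
  let ?rep = "\<lambda>a. SOME n. admissible p t n \<and> residue_class ?q n = a"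
  let ?\<kappa> = "\<lambda>a. power_map G (?rep a) <#\<^bsub>?B\<^esub> Hol G"
  interpret B: group ?B by (rule group_BijGroup)
  have NHol: "subgroup (NHol G) ?B"
    unfolding NHol_def by (intro B.normalizer_imp_subgroup subgroup.subset subgroup_Hol)
  interpret N: normal "Hol G" "?B\<lparr>carrier := NHol G\<rparr>"
    unfolding NHol_def by (rule B.subgroup_in_normalizer[OF subgroup_Hol])
  have \<kappa>: "?\<kappa> (residue_class ?q n) = power_map G n <#\<^bsub>?B\<^esub> Hol G" if n: "admissible p t n" for n
  proof -
    have "admissible p t (?rep (residue_class ?q n)) \<and> residue_class ?q (?rep (residue_class ?q n)) = residue_class ?q n"
      by (rule someI[of _ n]) (simp add: n)
    then show ?thesis using n by (intro power_map_coset_eq_iff[THEN iffD2]) auto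
  qed
  have coset: "power_map G n <#\<^bsub>?B\<^esub> Hol G = Hol G #>\<^bsub>?B\<^esub> power_map G n" if "admissible p t n" for n
    using N.coset_eq power_map_normalizes_Hol[OF that] by simp
  have hom: "group_hom ((units_of (ZFact ?q))\<lparr>carrier := T0 p r t\<rparr>) (NHol_mod_Hol G) ?\<kappa>"
  proof (intro group_hom.intro group_hom_axioms.intro)
    show "group ((units_of (ZFact ?q))\<lparr>carrier := T0 p r t\<rparr>)"
      using subgroup.subgroup_is_group[OF subgroup_T0] cring.axioms(1)[OF ZFact_is_cring]
      by (simp add: monoid.units_group ring.is_monoid)
    show "group (NHol_mod_Hol G)"
      unfolding NHol_mod_Hol_def by (rule N.factorgroup_is_group)
    show "?\<kappa> \<in> hom ((units_of (ZFact ?q))\<lparr>carrier := T0 p r t\<rparr>) (NHol_mod_Hol G)"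
    proof (rule homI)
      fix a assume "a \<in> carrier ((units_of (ZFact ?q))\<lparr>carrier := T0 p r t\<rparr>)"
      then obtain n where n: "admissible p t n" "a = residue_class ?q n" by (auto simp: T0_def)
      show "?\<kappa> a \<in> carrier (NHol_mod_Hol G)"
        unfolding n(2) \<kappa>[OF n(1)] coset[OF n(1)]
        using power_map_normalizes_Hol[OF n(1)] by (auto simp: NHol_mod_Hol_def carrier_FactGroup)
    next
      fix a b assume "a \<in> carrier ((units_of (ZFact ?q))\<lparr>carrier := T0 p r t\<rparr>)"
        "b \<in> carrier ((units_of (ZFact ?q))\<lparr>carrier := T0 p r t\<rparr>)"
      then obtain m n where mn: "admissible p t m" "a = residue_class ?q m"
        "admissible p t n" "b = residue_class ?q n" by (auto simp: T0_def)
      have ab: "a \<otimes>\<^bsub>(units_of (ZFact ?q))\<lparr>carrier := T0 p r t\<rparr>\<^esub> b = residue_class ?q (m * n)"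
        by (simp add: mn units_of_mult residue_class_mult)
      have "?\<kappa> a \<otimes>\<^bsub>NHol_mod_Hol G\<^esub> ?\<kappa> b = (Hol G #>\<^bsub>?B\<^esub> power_map G m) <#>\<^bsub>?B\<^esub> (Hol G #>\<^bsub>?B\<^esub> power_map G n)"
        unfolding mn(2,4) \<kappa>[OF mn(1)] \<kappa>[OF mn(3)] coset[OF mn(1)] coset[OF mn(3)]
        by (simp add: NHol_mod_Hol_def)
      also have "\<dots> = Hol G #>\<^bsub>?B\<^esub> (power_map G m \<otimes>\<^bsub>?B\<^esub> power_map G n)"
        using N.rcos_sum[of "power_map G m" "power_map G n"]
          power_map_normalizes_Hol[OF mn(1)] power_map_normalizes_Hol[OF mn(3)] by simp
      also have "\<dots> = ?\<kappa> (residue_class ?q (m * n))"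
        unfolding power_map_mult[OF mn(1,3)] \<kappa>[OF admissible_mult[OF mn(1,3)]]
          coset[OF admissible_mult[OF mn(1,3)]] ..
      finally show "?\<kappa> (a \<otimes>\<^bsub>(units_of (ZFact ?q))\<lparr>carrier := T0 p r t\<rparr>\<^esub> b) = ?\<kappa> a \<otimes>\<^bsub>NHol_mod_Hol G\<^esub> ?\<kappa> b"
        unfolding ab by (rule sym)
    qed
  qed
  have inj: "inj_on ?\<kappa> (T0 p r t)"
  proof (rule inj_onI)
    fix a b assume "a \<in> T0 p r t" "b \<in> T0 p r t" and eq: "?\<kappa> a = ?\<kappa> b"
    then obtain m n where mn: "admissible p t m" "a = residue_class ?q m"
      "admissible p t n" "b = residue_class ?q n" by (auto simp: T0_def)
    show "a = b"
      using eq power_map_coset_eq_iff[OF mn(1,3)] unfolding mn(2,4) \<kappa>[OF mn(1)] \<kappa>[OF mn(3)] by simp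
  qed
  show ?thesis
    by (rule exI[of _ ?\<kappa>]) (intro conjI allI impI \<kappa> hom inj)
qed

end

section \<open>Exponents of groups\<close>

context group
begin

lemma
  assumes "finite (carrier G)"
  shows pow_group_exponent: "x \<in> carrier G \<Longrightarrow> x [^] group_exponent G = \<one>"
    and group_exponent_dvd: "(\<And>x. x \<in> carrier G \<Longrightarrow> x [^] (m :: nat) = \<one>) \<Longrightarrow> group_exponent G dvd m"
proof -
  let ?P = "\<lambda>n :: nat. 0 < n \<and> (\<forall>x\<in>carrier G. x [^] n = \<one>)"
  have "?P (order G)"
    using assms pow_order_eq_1 by (simp add: order_gt_0_iff_finite)
  then have e: "?P (group_exponent G)"
    unfolding group_exponent_def by (rule LeastI)
  then show "x \<in> carrier G \<Longrightarrow> x [^] group_exponent G = \<one>" by blast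
  assume m: "\<And>x. x \<in> carrier G \<Longrightarrow> x [^] m = \<one>"
  let ?l = "m mod group_exponent G"
  have "x [^] ?l = \<one>" if x: "x \<in> carrier G" for x
  proof -
    have "x [^] m = x [^] (group_exponent G * (m div group_exponent G)) \<otimes> x [^] ?l"
      using x by (simp add: nat_pow_mult)
    also have "x [^] (group_exponent G * (m div group_exponent G)) = \<one>"
      using e x by (simp flip: nat_pow_pow)
    finally show ?thesis using m[OF x] x by simp
  qed
  then have "?P ?l" if "0 < ?l" using that by simp
  moreover have "\<not> ?P ?l"
    unfolding group_exponent_def[symmetric] using e
    by (intro not_less_Least[of ?l ?P, folded group_exponent_def]) simp
  ultimately have "?l = 0" by (cases "0 < ?l") simp_all
  then show "group_exponent G dvd m" by (simp add: mod_eq_0_iff_dvd)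
qed

lemma group_center_normal: "group_center G \<lhd> G"
proof -
  have ZD: "a \<in> carrier G" "\<And>x. x \<in> carrier G \<Longrightarrow> a \<otimes> x = x \<otimes> a" if "a \<in> group_center G" for a
    using that by (simp_all add: group_center_def)
  have "subgroup (group_center G) G"
  proof (rule subgroupI)
    show "group_center G \<subseteq> carrier G" using ZD(1) by blast
    have "\<one> \<in> group_center G" by (simp add: group_center_def)
    then show "group_center G \<noteq> {}" by blast
  next
    fix a assume a: "a \<in> group_center G"
    have "inv a \<otimes> x = x \<otimes> inv a" if x: "x \<in> carrier G" for x
    proof -
      have "inv (inv x \<otimes> a) = inv (a \<otimes> inv x)"
        using ZD(2)[OF a, of "inv x"] x by simp
      then show ?thesis using ZD(1)[OF a] x by (simp add: inv_mult_group)
    qed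
    then show "inv a \<in> group_center G" using ZD(1)[OF a] by (simp add: group_center_def)
  next
    fix a b assume a: "a \<in> group_center G" and b: "b \<in> group_center G"
    have "a \<otimes> b \<otimes> x = x \<otimes> (a \<otimes> b)" if x: "x \<in> carrier G" for x
    proof -
      have "a \<otimes> b \<otimes> x = (a \<otimes> x) \<otimes> b"
        using ZD(1)[OF a] ZD(1)[OF b] x ZD(2)[OF b x] by (simp add: m_assoc)
      then show ?thesis
        using ZD(1)[OF a] ZD(1)[OF b] x ZD(2)[OF a x] by (simp add: m_assoc)
    qed
    then show "a \<otimes> b \<in> group_center G"
      using ZD(1)[OF a] ZD(1)[OF b] by (simp add: group_center_def)
  qed
  moreover have "x \<otimes> a \<otimes> inv x \<in> group_center G" if x: "x \<in> carrier G" and a: "a \<in> group_center G" for x a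
  proof -
    have "x \<otimes> a \<otimes> inv x = a"
      using ZD(2)[OF a x, symmetric] ZD(1)[OF a] x by (simp add: m_assoc)
    then show ?thesis using a by simp
  qed
  ultimately show ?thesis
    by (simp add: normal_inv_iff)
qed

lemma group_exponent_mod_center:
  assumes "finite (carrier G)"
  shows "x \<in> carrier G \<Longrightarrow> x [^] group_exponent (G Mod group_center G) \<in> group_center G"
    and "(\<And>x. x \<in> carrier G \<Longrightarrow> x [^] (m :: nat) \<in> group_center G)
      \<Longrightarrow> group_exponent (G Mod group_center G) dvd m"
proof -
  interpret Z: normal "group_center G" G by (rule group_center_normal)
  interpret Q: group "G Mod group_center G" by (rule Z.factorgroup_is_group)
  have fin: "finite (carrier (G Mod group_center G))"
    using assms by (simp add: carrier_FactGroup)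
  have coset: "group_center G #> x \<in> carrier (G Mod group_center G)" if "x \<in> carrier G" for x
    using that by (auto simp: carrier_FactGroup)
  have iff: "(group_center G #> x) [^]\<^bsub>G Mod group_center G\<^esub> n = \<one>\<^bsub>G Mod group_center G\<^esub>
      \<longleftrightarrow> x [^] n \<in> group_center G" if "x \<in> carrier G" for x and n :: nat
    using that by (simp add: Z.FactGroup_pow)
      (metis Z.subgroup_axioms coset_join1 coset_join2 nat_pow_closed Z.subset)
  show "x \<in> carrier G \<Longrightarrow> x [^] group_exponent (G Mod group_center G) \<in> group_center G"
    using Q.pow_group_exponent[OF fin coset] iff by blast
  assume m: "\<And>x. x \<in> carrier G \<Longrightarrow> x [^] m \<in> group_center G"
  show "group_exponent (G Mod group_center G) dvd m"
  proof (rule Q.group_exponent_dvd[OF fin])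
    fix a assume "a \<in> carrier (G Mod group_center G)"
    then obtain x where x: "x \<in> carrier G" "a = group_center G #> x"
      by (auto simp: carrier_FactGroup)
    show "a [^]\<^bsub>G Mod group_center G\<^esub> m = \<one>\<^bsub>G Mod group_center G\<^esub>"
      unfolding x(2) by (rule iff[OF x(1), THEN iffD2, OF m[OF x(1)]])
  qed
qed

end

section \<open>The homomorphism given by power maps\<close>

theorem theorem3p1:
  fixes G :: "('a, 'b) monoid_scheme" and p k c r t :: nat
  assumes "Factorial_Ring.prime p" and "odd p"
    and "group G" and "order G = p ^ k"
    and "has_nilpotency_class G c" and "2 \<le> c" and "c \<le> p - 1"
    and "group_exponent (G Mod group_center G) = p ^ r"
    and "group_exponent (G\<lparr>carrier := lower_central_series G 3\<rparr>) = p ^ t"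
  shows "subgroup (T0 p r t) (units_of (ZFact (int p ^ r)))
    \<and> (\<forall>n. admissible p t n \<longrightarrow> power_map G n \<in> NHol G)
    \<and> (\<forall>m n. admissible p t m \<and> admissible p t n \<and>
          residue_class (int p ^ r) m = residue_class (int p ^ r) n \<longrightarrow>
          power_map G m <#\<^bsub>BijGroup (carrier G)\<^esub> Hol G
            = power_map G n <#\<^bsub>BijGroup (carrier G)\<^esub> Hol G)
    \<and> (\<exists>\<kappa>. (\<forall>n. admissible p t n \<longrightarrow>
               \<kappa> (residue_class (int p ^ r) n)
                 = power_map G n <#\<^bsub>BijGroup (carrier G)\<^esub> Hol G)
          \<and> group_hom ((units_of (ZFact (int p ^ r)))\<lparr>carrier := T0 p r t\<rparr>) (NHol_mod_Hol G) \<kappa>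
          \<and> inj_on \<kappa> (T0 p r t))"
proof -
  interpret group G by fact
  have "0 < order G" using assms(1,4) prime_gt_0_nat by simp
  then have fin: "finite (carrier G)" by (simp add: order_gt_0_iff_finite)
  interpret small_class_p_group G p t k r
  proof (intro small_class_p_group.intro small_class_group.intro small_class_group_axioms.intro
      small_class_p_group_axioms.intro assms(1-4))
    interpret L: filtered_group G "lower_central_series G"
      by (rule lower_central_series_filtered_group)
    have "c + 1 \<le> p" using assms(7) prime_gt_1_nat[OF assms(1)] by simp
    then have "lower_central_series G p \<subseteq> {\<one>\<^bsub>G\<^esub>}"
      using assms(5) L.F_mono by (metis has_nilpotency_class_def)
    then show "lower_central_series G p = {\<one>\<^bsub>G\<^esub>}"
      using subgroup.one_closed[OF L.subgroup_F] by blast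
    show "z [^]\<^bsub>G\<^esub> (p ^ t) = \<one>\<^bsub>G\<^esub>" if z: "z \<in> lower_central_series G 3" for z
    proof -
      interpret L3: group "G\<lparr>carrier := lower_central_series G 3\<rparr>"
        by (rule subgroup.subgroup_is_group[OF L.subgroup_F group_axioms])
      have "finite (lower_central_series G 3)"
        using fin L.F_carrier by (meson finite_subset subsetI)
      then have "z [^]\<^bsub>G\<lparr>carrier := lower_central_series G 3\<rparr>\<^esub> p ^ t = \<one>\<^bsub>G\<^esub>"
        using L3.pow_group_exponent[of z] z by (simp add: assms(9))
      then show ?thesis by (simp flip: nat_pow_consistent)
    qed
    show "x [^]\<^bsub>G\<^esub> (p ^ r) \<otimes>\<^bsub>G\<^esub> y = y \<otimes>\<^bsub>G\<^esub> x [^]\<^bsub>G\<^esub> (p ^ r)" if "x \<in> carrier G" "y \<in> carrier G" for x y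
      using group_exponent_mod_center(1)[OF fin that(1), unfolded assms(8)] that(2) by (simp add: group_center_def)
    show "p ^ r dvd m" if "\<And>x y. x \<in> carrier G \<Longrightarrow> y \<in> carrier G \<Longrightarrow> x [^]\<^bsub>G\<^esub> m \<otimes>\<^bsub>G\<^esub> y = y \<otimes>\<^bsub>G\<^esub> x [^]\<^bsub>G\<^esub> m" for m :: nat
      using group_exponent_mod_center(2)[OF fin, of m, unfolded assms(8)] that by (simp add: group_center_def)
  qed
  show ?thesis
    using power_map_normalizes_Hol power_map_coset_eq_iff
    by (intro conjI subgroup_T0 power_map_quotient_hom) blast+
qed

end
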